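(* The distribution of $Y_n$ is asymptotically normal, namely, as $n\to\infty$, \[ \frac{Y_n-\mu_n}{\sigma_n} \stackrel{d}{\to}\mathscr{N}(0,1), \] where $\mu_n=\mathbb{E}(Y_n)$, $\sigma_n^2=\mathbb{V}(Y_n)$, and $\stackrel{d}{\to}$ denotes convergence in distribution.
   Context: Fix $0<p<1$. The random variables $Y_n$ are defined in distribution by $Y_0=0$, $Y_1=1$ and \[ Y_n \stackrel{d}{=} Y_{n-1} + Y^*_{n-1-\mathrm{Binom}(n-1;p)}\qquad(n\ge2), \] where $Y_k^*$ is a copy of $Y_k$, $\mathrm{Binom}(n-1;p)$ is a binomial random variable with parameters $n-1$ and $p$, and $Y_{n-1}$, $(Y^*_k)_k$ and the binomial variable are independent. $\mathscr{N}(0,1)$ is the standard normal distribution. *)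

theory Defs
  imports "HOL-Probability.Probability"
begin

text \<open>
  Only the distribution of each \<open>Y\<^sub>n\<close> is specified, so the sequence is given by its laws.
  Conditioning on the value \<open>k\<close> of the binomial variable turns the independent copy with random
  index, \<open>Y\<^sup>*\<close> at \<open>n - 1 - k\<close>, into a mixture; \<open>Y_pmf_rec\<close> below is the recurrence with the
  independent family of copies written out.
  For \<open>0 \<le> p \<le> 1\<close> the support of \<open>binomial_pmf (n - 1) p\<close> is within \<open>{..n - 1}\<close>, so the
  truncated subtraction on \<^typ>\<open>nat\<close> is the true one.
\<close>

function Y_pmf :: "real \<Rightarrow> nat \<Rightarrow> nat pmf" where
  "Y_pmf p n =
     (if n = 0 then return_pmf 0
      else if n = 1 then return_pmf 1
      else do {
        y \<leftarrow> Y_pmf p (n - 1);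
        k \<leftarrow> binomial_pmf (n - 1) p;
        y' \<leftarrow> Y_pmf p (n - 1 - k);
        return_pmf (y + y')
      })"
  by auto
termination
  by (relation "Wellfounded.measure snd") auto

declare Y_pmf.simps [simp del]

lemma Y_pmf_0: "Y_pmf p 0 = return_pmf 0"
  and Y_pmf_1: "Y_pmf p 1 = return_pmf 1"
  by (simp_all add: Y_pmf.simps)

lemma Y_pmf_rec:
  assumes "n \<ge> 2"
  shows "Y_pmf p n =
    map_pmf (\<lambda>(y, k, ystar). y + ystar (n - 1 - k))
      (pair_pmf (Y_pmf p (n - 1))
        (pair_pmf (binomial_pmf (n - 1) p)
          (Pi_pmf {..n - 1} 0 (Y_pmf p))))"
proof -
  have component: "Y_pmf p (n - 1 - k) = map_pmf (\<lambda>f. f (n - 1 - k)) (Pi_pmf {..n - 1} 0 (Y_pmf p))" for k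
    by (subst Pi_pmf_component) auto
  have "Y_pmf p n = do {
        y \<leftarrow> Y_pmf p (n - 1);
        k \<leftarrow> binomial_pmf (n - 1) p;
        y' \<leftarrow> Y_pmf p (n - 1 - k);
        return_pmf (y + y')}"
    using assms by (subst Y_pmf.simps) auto
  also have "\<dots> = do {
        y \<leftarrow> Y_pmf p (n - 1);
        k \<leftarrow> binomial_pmf (n - 1) p;
        f \<leftarrow> Pi_pmf {..n - 1} 0 (Y_pmf p);
        return_pmf (y + f (n - 1 - k))}"
    by (subst component) (simp add: bind_map_pmf)
  also have "\<dots> = map_pmf (\<lambda>(y, k, ystar). y + ystar (n - 1 - k))
      (pair_pmf (Y_pmf p (n - 1))
        (pair_pmf (binomial_pmf (n - 1) p)
          (Pi_pmf {..n - 1} 0 (Y_pmf p))))"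
    by (simp add: pair_pmf_def map_bind_pmf bind_assoc_pmf bind_return_pmf)
  finally show ?thesis .
qed

definition Y_mean :: "real \<Rightarrow> nat \<Rightarrow> real" where
  "Y_mean p n = measure_pmf.expectation (Y_pmf p n) real"

definition Y_sd :: "real \<Rightarrow> nat \<Rightarrow> real" where
  "Y_sd p n = sqrt (measure_pmf.variance (Y_pmf p n) real)"

end

theory Submission
  imports Defs
begin

text \<open>
  Put \<open>q = 1 - p\<close> and let \<open>B\<^sub>n\<close> be binomial with parameters \<open>n\<close> and \<open>q\<close>. Unrolling the recurrence
  writes the law of \<open>Y\<^sub>N\<close> as that of a sum of independent variables, the \<open>n\<close>-th of them distributed
  like \<open>Y\<close> at the random index \<open>B\<^sub>n\<close>. With \<open>m\<^sub>k\<close> and \<open>V\<^sub>k\<close> the mean and variance of \<open>Y\<^sub>k\<close>, each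
  centred summand splits into three uncorrelated pieces:
  the fluctuation of \<open>Y\<close> around \<open>m\<close> at the drawn index, of variance \<open>E V(B\<^sub>n)\<close>;
  the linear regression \<open>s (B\<^sub>n - n q)\<close> of \<open>m(B\<^sub>n)\<close> on \<open>B\<^sub>n\<close>; and the rest of \<open>m(B\<^sub>n)\<close>.
  The first and the third are negligible in the quadratic mean compared with the second. The second is
  itself a sum of \<open>n\<close> independent centred Bernoulli variables scaled by \<open>s\<close>. So \<open>Y\<^sub>N\<close> is close to a sum
  of independent, uniformly small variables, and the Lyapunov method with characteristic functions
  applies.

  Why the two pieces are negligible: \<open>m\<close> grows faster than every power of \<open>n\<close>, but its relative
  growth \<open>(m\<^sub>n\<^sub>+\<^sub>1 - m\<^sub>n) / m\<^sub>n\<close> is small, of order \<open>log n / n\<close>. A bound \<open>O(n\<^sup>-\<^sup>\<gamma>)\<close> with some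
  \<open>\<gamma>\<close> strictly between \<open>1/2\<close> and \<open>1\<close> is enough, and \<open>\<gamma> = 3/4\<close> is used. It is proved
  by induction in \<open>incr_le_decay_m\<close>: the increments of \<open>m\<close> are binomial averages of \<open>m\<close>, and the average
  of \<open>k\<^sup>-\<^sup>\<gamma>\<close> is about \<open>q\<^sup>-\<^sup>\<gamma> n\<^sup>-\<^sup>\<gamma>\<close>, so that the increments themselves have relative growth smaller
  by the factor \<open>q\<^sup>1\<^sup>-\<^sup>\<gamma> < 1\<close>, which the induction can spend. Each further averaging costs another
  factor \<open>n\<^sup>-\<^sup>\<gamma>\<close>. Since \<open>2 \<gamma> > 1\<close>, the Poincare inequality \<open>Var f(B\<^sub>n) \<le> n p q E (\<Delta>f)\<^sup>2\<close> then shows that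
  \<open>\<Delta>m(B\<^sub>n)\<close> has a variance much smaller than the square of its mean, which makes \<open>m(B\<^sub>n)\<close> nearly linear
  in \<open>B\<^sub>n\<close> (\<open>index_variance_le\<close>); and summing up the variances gives
  \<open>V\<^sub>n = O(\<surd>n (\<Delta>m\<^sub>n)\<^sup>2)\<close>, which makes the first piece small (\<open>avg_V_le\<close>).
\<close>

section \<open>Averages over a binomial index\<close>

locale binomial_average =
  fixes q :: real
  assumes q_pos: "0 < q" and q_less_1: "q < 1"
begin

definition avg :: "nat \<Rightarrow> (nat \<Rightarrow> 'a :: {banach, second_countable_topology}) \<Rightarrow> 'a" where
  "avg n f = measure_pmf.expectation (binomial_pmf n q) f"

lemma avg_integrable:
  fixes f :: "nat \<Rightarrow> 'a :: {banach, second_countable_topology}"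
  shows "integrable (binomial_pmf n q) f"
  using q_pos q_less_1 by (intro integrable_measure_pmf_finite finite_set_pmf_binomial_pmf) auto

lemma avg_0 [simp]: "avg 0 f = f 0"
  using q_pos q_less_1 by (simp add: avg_def binomial_pmf_0)

text \<open>
  The last of the \<open>n + 1\<close> Bernoulli trials is split off; the inductions on the number of trials
  below all rest on this recursion.
\<close>
lemma avg_Suc: "avg (Suc n) f = (1 - q) *\<^sub>R avg n f + q *\<^sub>R avg n (\<lambda>k. f (Suc k))"
proof -
  have fin: "finite (set_pmf (binomial_pmf n q))"
    using q_pos q_less_1 by (intro finite_set_pmf_binomial_pmf) auto
  have "avg (Suc n) f = measure_pmf.expectation (bernoulli_pmf q \<bind>
      (\<lambda>b. map_pmf (\<lambda>k. (if b then 1 else 0) + k) (binomial_pmf n q))) f"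
    using q_pos q_less_1 by (simp add: avg_def binomial_pmf_Suc map_pmf_def)
  also have "\<dots> = (\<Sum>b\<in>UNIV. pmf (bernoulli_pmf q) b *\<^sub>R
      measure_pmf.expectation (map_pmf (\<lambda>k. (if b then 1 else 0) + k) (binomial_pmf n q)) f)"
    using fin by (intro pmf_expectation_bind) auto
  also have "\<dots> = (1 - q) *\<^sub>R avg n f + q *\<^sub>R avg n (\<lambda>k. f (Suc k))"
    using q_pos q_less_1 by (simp add: UNIV_bool avg_def)
  finally show ?thesis .
qed

lemma avg_Suc_real:
  "avg (Suc n) (f :: nat \<Rightarrow> real) = (1 - q) * avg n f + q * avg n (\<lambda>k. f (Suc k))"
  by (simp add: avg_Suc)

lemma avg_add: "avg n (\<lambda>k. f k + g k) = avg n f + avg n g"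
  unfolding avg_def by (intro Bochner_Integration.integral_add avg_integrable)

lemma avg_diff: "avg n (\<lambda>k. f k - g k) = avg n f - avg n g"
  unfolding avg_def by (intro Bochner_Integration.integral_diff avg_integrable)

lemma avg_cmult: "avg n (\<lambda>k. c * f k) = (c :: 'a :: {real_normed_field, banach, second_countable_topology}) * avg n f"
  unfolding avg_def by simp

lemma avg_const [simp]: "avg n (\<lambda>k. c) = c"
  unfolding avg_def by simp

lemma avg_of_real: "avg n (\<lambda>k. complex_of_real (f k)) = complex_of_real (avg n f)"
  unfolding avg_def by (rule integral_complex_of_real)

lemma avg_mono:
  fixes f g :: "nat \<Rightarrow> real"
  assumes "\<And>k. k \<le> n \<Longrightarrow> f k \<le> g k"
  shows "avg n f \<le> avg n g"
  unfolding avg_def using assms q_pos q_less_1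
  by (intro integral_mono_AE avg_integrable) (auto simp: AE_measure_pmf_iff)

lemma avg_cong:
  assumes "\<And>k. k \<le> n \<Longrightarrow> f k = g k"
  shows "avg n f = avg n g"
  unfolding avg_def using assms q_pos q_less_1
  by (intro integral_cong_AE) (auto simp: AE_measure_pmf_iff)

lemma avg_nonneg:
  fixes f :: "nat \<Rightarrow> real"
  assumes "\<And>k. k \<le> n \<Longrightarrow> 0 \<le> f k"
  shows "0 \<le> avg n f"
  using avg_mono[of n "\<lambda>_. 0" f] assms by simp

lemma norm_avg_le: "norm (avg n f) \<le> avg n (\<lambda>k. norm (f k))"
  unfolding avg_def by (rule integral_norm_bound)

lemma avg_Suc_diff:
  fixes f :: "nat \<Rightarrow> real"
  shows "avg (Suc n) f - avg n f = q * avg n (\<lambda>k. f (Suc k) - f k)"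
  by (simp add: avg_Suc avg_diff algebra_simps)

lemma avg_Suc_ge:
  fixes f :: "nat \<Rightarrow> real"
  assumes "mono f"
  shows "avg n f \<le> avg (Suc n) f"
proof -
  have "0 \<le> q * avg n (\<lambda>k. f (Suc k) - f k)"
    using q_pos assms by (intro mult_nonneg_nonneg avg_nonneg) (auto simp: mono_iff_le_Suc)
  then show ?thesis using avg_Suc_diff[of n f] by linarith
qed

lemma avg_mono_index:
  fixes f :: "nat \<Rightarrow> real"
  assumes "mono f"
  shows "mono (\<lambda>n. avg n f)"
  using avg_Suc_ge[OF assms] by (simp add: mono_iff_le_Suc)

lemma avg_le_top:
  fixes f :: "nat \<Rightarrow> real"
  assumes "mono f"
  shows "avg n f \<le> f n"
  using avg_mono[of n f "\<lambda>_. f n"] assms by (auto simp: mono_def)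

text \<open>
  Weighting a binomial variable by its own value amounts to conditioning one trial to be a success.
\<close>
lemma avg_size_bias:
  fixes f :: "nat \<Rightarrow> real"
  shows "avg (Suc n) (\<lambda>k. real k * f k) = real (Suc n) * q * avg n (\<lambda>k. f (Suc k))"
proof (induction n arbitrary: f)
  case 0
  then show ?case by (simp add: avg_Suc)
next
  case (Suc n)
  have "avg (Suc (Suc n)) (\<lambda>k. real k * f k)
      = (1 - q) * avg (Suc n) (\<lambda>k. real k * f k)
        + q * (avg (Suc n) (\<lambda>k. real k * f (Suc k)) + avg (Suc n) (\<lambda>k. f (Suc k)))"
    by (subst avg_Suc) (simp add: algebra_simps flip: avg_add)
  also have "\<dots> = real (Suc n) * q * avg (Suc n) (\<lambda>k. f (Suc k)) + q * avg (Suc n) (\<lambda>k. f (Suc k))"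
    unfolding Suc.IH by (simp add: avg_Suc_real[of n "\<lambda>k. f (Suc k)"] algebra_simps)
  finally show ?case by (simp add: algebra_simps)
qed

text \<open>
  The covariance of \<open>B\<close> and \<open>f(B)\<close>, a discrete counterpart of Gaussian integration by parts. It
  identifies the regression coefficient of \<open>f(B)\<close> on \<open>B\<close> as an averaged difference of \<open>f\<close>.
\<close>
lemma avg_stein:
  fixes f :: "nat \<Rightarrow> real"
  shows "avg (Suc n) (\<lambda>k. (real k - real (Suc n) * q) * f k)
    = real (Suc n) * q * (1 - q) * avg n (\<lambda>k. f (Suc k) - f k)"
proof -
  have "avg (Suc n) (\<lambda>k. (real k - real (Suc n) * q) * f k)
      = avg (Suc n) (\<lambda>k. real k * f k) - real (Suc n) * q * avg (Suc n) f"
    by (simp add: left_diff_distrib avg_diff avg_cmult del: of_nat_Suc)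
  then show ?thesis
    unfolding avg_size_bias by (simp add: avg_Suc avg_diff algebra_simps)
qed

lemma avg_centred: "avg n (\<lambda>k. real k - real n * q) = 0"
  using avg_stein[of _ "\<lambda>_. 1"] by (cases n) auto

lemma avg_centred_square: "avg n (\<lambda>k. (real k - real n * q)\<^sup>2) = real n * q * (1 - q)"
proof (cases n)
  case (Suc j)
  have "avg (Suc j) (\<lambda>k. (real k - real (Suc j) * q) * (real k - real (Suc j) * q)) =
      real (Suc j) * q * (1 - q)"
    by (subst avg_stein) simp
  then show ?thesis using Suc by (simp add: power2_eq_square)
qed simp

lemma avg_square_expand:
  fixes f :: "nat \<Rightarrow> real"
  shows "avg n (\<lambda>k. (f k - c)\<^sup>2) = avg n (\<lambda>k. (f k)\<^sup>2) - 2 * c * avg n f + c\<^sup>2"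
proof -
  have "avg n (\<lambda>k. (f k - c)\<^sup>2) = avg n (\<lambda>k. ((f k)\<^sup>2 - (2 * c) * f k) + c\<^sup>2)"
    by (simp add: power2_diff algebra_simps)
  also have "\<dots> = avg n (\<lambda>k. (f k)\<^sup>2) - 2 * c * avg n f + c\<^sup>2"
    by (subst avg_add, subst avg_diff, subst avg_cmult) simp
  finally show ?thesis .
qed

lemma avg_variance:
  fixes f :: "nat \<Rightarrow> real"
  shows "avg n (\<lambda>k. (f k - avg n f)\<^sup>2) = avg n (\<lambda>k. (f k)\<^sup>2) - (avg n f)\<^sup>2"
  by (subst avg_square_expand) (simp add: power2_eq_square)

lemma avg_jensen_square:
  fixes f :: "nat \<Rightarrow> real"
  shows "(avg n f)\<^sup>2 \<le> avg n (\<lambda>k. (f k)\<^sup>2)"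
  using avg_nonneg[of n "\<lambda>k. (f k - avg n f)\<^sup>2"] unfolding avg_variance by simp

text \<open>
  The Poincare inequality of the binomial distribution. The last trial contributes exactly
  \<open>q (1 - q) (\<Delta>f)\<^sup>2\<close> on average to the variance; the remaining variance is that of \<open>f\<close> averaged over the
  last trial, whose differences are averages of differences of \<open>f\<close>, so that Jensen's inequality
  applies to them.
\<close>
lemma avg_poincare:
  fixes f :: "nat \<Rightarrow> real"
  shows "avg n (\<lambda>k. (f k)\<^sup>2) - (avg n f)\<^sup>2
    \<le> real n * q * (1 - q) * avg (n - 1) (\<lambda>k. (f (Suc k) - f k)\<^sup>2)"
proof (induction n arbitrary: f)
  case 0
  then show ?case by simp
next
  case (Suc n)
  define h where "h k = (1 - q) * f k + q * f (Suc k)" for k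
  let ?d = "\<lambda>k. (f (Suc k) - f k)\<^sup>2"
  have sq: "(1 - q) * (f k)\<^sup>2 + q * (f (Suc k))\<^sup>2 = (h k)\<^sup>2 + q * (1 - q) * ?d k" for k
    unfolding h_def by (simp add: power2_eq_square algebra_simps)
  have 1: "avg (Suc n) f = avg n h"
    unfolding h_def by (subst avg_Suc) (simp add: avg_add avg_cmult)
  have 2: "avg (Suc n) (\<lambda>k. (f k)\<^sup>2) = avg n (\<lambda>k. (h k)\<^sup>2) + q * (1 - q) * avg n ?d"
  proof -
    have "avg (Suc n) (\<lambda>k. (f k)\<^sup>2) = avg n (\<lambda>k. (1 - q) * (f k)\<^sup>2 + q * (f (Suc k))\<^sup>2)"
      by (subst avg_Suc) (simp add: avg_add avg_cmult)
    also have "\<dots> = avg n (\<lambda>k. (h k)\<^sup>2 + q * (1 - q) * ?d k)"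
      by (simp only: sq)
    finally show ?thesis by (simp add: avg_add avg_cmult)
  qed
  have dh: "real n * avg (n - 1) (\<lambda>k. (h (Suc k) - h k)\<^sup>2) \<le> real n * avg n ?d"
  proof (cases n)
    case (Suc j)
    have "(h (Suc k) - h k)\<^sup>2 \<le> (1 - q) * ?d k + q * ?d (Suc k)" for k
    proof -
      let ?x = "f (Suc k) - f k" and ?y = "f (Suc (Suc k)) - f (Suc k)"
      have "h (Suc k) - h k = (1 - q) * ?x + q * ?y" unfolding h_def by (simp add: algebra_simps)
      moreover have "(1 - q) * ?x\<^sup>2 + q * ?y\<^sup>2 - ((1 - q) * ?x + q * ?y)\<^sup>2 = q * (1 - q) * (?x - ?y)\<^sup>2"
        by (simp add: power2_eq_square algebra_simps)
      moreover have "0 \<le> q * (1 - q) * (?x - ?y)\<^sup>2" using q_pos q_less_1 by simp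
      ultimately show ?thesis by (metis diff_ge_0_iff_ge)
    qed
    then have "avg j (\<lambda>k. (h (Suc k) - h k)\<^sup>2) \<le> avg j (\<lambda>k. (1 - q) * ?d k + q * ?d (Suc k))"
      by (intro avg_mono)
    also have "\<dots> = avg (Suc j) ?d" by (subst avg_Suc) (simp add: avg_add avg_cmult)
    finally show ?thesis using Suc by (simp add: mult_left_mono)
  qed simp
  have "avg (Suc n) (\<lambda>k. (f k)\<^sup>2) - (avg (Suc n) f)\<^sup>2
      \<le> q * (1 - q) * (real n * avg (n - 1) (\<lambda>k. (h (Suc k) - h k)\<^sup>2)) + q * (1 - q) * avg n ?d"
    unfolding 1 2 using Suc.IH[of h] by (simp add: algebra_simps)
  also have "\<dots> \<le> q * (1 - q) * (real n * avg n ?d) + q * (1 - q) * avg n ?d"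
    using q_pos q_less_1 by (intro add_right_mono mult_left_mono dh) auto
  finally show ?case by (simp add: algebra_simps)
qed

text \<open>
  Chebyshev's association inequality: every trial adds to the difference of the two
  sides a product of a decrease of \<open>f\<close> and an increase of \<open>g\<close>.
\<close>
lemma avg_chebyshev:
  fixes f g :: "nat \<Rightarrow> real"
  assumes "antimono f" "mono g"
  shows "avg n (\<lambda>k. f k * g k) \<le> avg n f * avg n g"
  using assms
proof (induction n arbitrary: f g)
  case 0
  then show ?case by simp
next
  case (Suc n)
  let ?F = "avg n f" and ?F' = "avg n (\<lambda>k. f (Suc k))"
  let ?G = "avg n g" and ?G' = "avg n (\<lambda>k. g (Suc k))"
  have s: "antimono (\<lambda>k. f (Suc k))" "mono (\<lambda>k. g (Suc k))"
    using Suc.prems by (auto simp: antimono_def mono_def)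
  have le: "?F' \<le> ?F" "?G \<le> ?G'"
    using Suc.prems by (auto intro!: avg_mono simp: antimono_iff_le_Suc mono_iff_le_Suc)
  have "avg (Suc n) (\<lambda>k. f k * g k) \<le> (1 - q) * (?F * ?G) + q * (?F' * ?G')"
    unfolding avg_Suc_real using Suc.IH[OF Suc.prems] Suc.IH[OF s] q_pos q_less_1
    by (intro add_mono mult_left_mono) auto
  also have "\<dots> = ((1 - q) * ?F + q * ?F') * ((1 - q) * ?G + q * ?G') - q * (1 - q) * ((?F - ?F') * (?G' - ?G))"
    by (simp add: algebra_simps)
  also have "\<dots> \<le> ((1 - q) * ?F + q * ?F') * ((1 - q) * ?G + q * ?G')"
    using le q_pos q_less_1 by simp
  finally show ?case by (simp add: avg_Suc)
qed

lemma avg_inverse_Suc: "avg n (\<lambda>k. 1 / real (Suc k)) \<le> 1 / (real (Suc n) * q)"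
proof -
  have "real (Suc n) * q * avg n (\<lambda>k. 1 / real (Suc k)) = avg (Suc n) (\<lambda>k. real k * (1 / real k))"
    by (subst avg_size_bias) simp
  also have "\<dots> \<le> avg (Suc n) (\<lambda>_. 1)" by (intro avg_mono) auto
  finally show ?thesis using q_pos by (simp add: pos_le_divide_eq mult_ac del: of_nat_Suc)
qed

lemma avg_inverse_square: "avg n (\<lambda>k. 1 / (real (Suc k))\<^sup>2) \<le> 2 / (real (Suc n) * q)\<^sup>2"
proof -
  let ?N = "real (Suc n)"
  have "?N * q * avg n (\<lambda>k. 1 / (real (Suc k) * real (Suc (Suc k))))
      = avg (Suc n) (\<lambda>k. real k * (1 / (real k * real (Suc k))))"
    by (subst avg_size_bias) simp
  also have "\<dots> \<le> avg (Suc n) (\<lambda>k. 1 / real (Suc k))" by (intro avg_mono) auto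
  also have "\<dots> \<le> 1 / (real (Suc (Suc n)) * q)" by (rule avg_inverse_Suc)
  also have "\<dots> \<le> 1 / (?N * q)" using q_pos by (intro divide_left_mono) auto
  finally have *: "avg n (\<lambda>k. 1 / (real (Suc k) * real (Suc (Suc k)))) \<le> 1 / (?N * q)\<^sup>2"
    using q_pos by (simp add: pos_le_divide_eq power2_eq_square mult_ac del: of_nat_Suc)
  have "avg n (\<lambda>k. 1 / (real (Suc k))\<^sup>2) \<le> avg n (\<lambda>k. 2 * (1 / (real (Suc k) * real (Suc (Suc k)))))"
  proof (intro avg_mono)
    fix k
    have "real (Suc k) * real (Suc (Suc k)) \<le> 2 * (real (Suc k))\<^sup>2"
      by (simp add: power2_eq_square algebra_simps)
    then have "2 / (2 * (real (Suc k))\<^sup>2) \<le> 2 / (real (Suc k) * real (Suc (Suc k)))"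
      by (intro divide_left_mono) auto
    then show "1 / (real (Suc k))\<^sup>2 \<le> 2 * (1 / (real (Suc k) * real (Suc (Suc k))))"
      by simp
  qed
  also have "\<dots> = 2 * avg n (\<lambda>k. 1 / (real (Suc k) * real (Suc (Suc k))))" by (rule avg_cmult)
  finally show ?thesis using * by simp
qed

text \<open>
  Jensen's inequality for the concave function \<open>x\<^sup>t\<close>; Young's inequality supplies its tangent at the
  mean.
\<close>
lemma avg_powr_le:
  fixes f :: "nat \<Rightarrow> real"
  assumes pos: "\<And>k. f k > 0" and "0 < t" "t < 1"
  shows "avg n (\<lambda>k. f k powr t) \<le> avg n f powr t"
proof -
  define y where "y = avg n f"
  have "0 < y"
  proof -
    define c where "c = Min (f ` {..n})"
    have "0 < c" unfolding c_def using pos by (subst Min_gr_iff) auto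
    moreover have "avg n (\<lambda>_. c) \<le> avg n f" unfolding c_def by (intro avg_mono) auto
    ultimately show ?thesis by (simp add: y_def)
  qed
  have le: "f k powr t \<le> y powr (t - 1) * (t * f k + (1 - t) * y)" for k
  proof -
    have "f k powr t * y powr (1 - t) \<le> t * f k + (1 - t) * y"
      using assms \<open>0 < y\<close> by (intro Youngs_inequality_0) auto
    then have "y powr (t - 1) * (f k powr t * y powr (1 - t)) \<le> y powr (t - 1) * (t * f k + (1 - t) * y)"
      by (intro mult_left_mono) auto
    also have "y powr (t - 1) * (f k powr t * y powr (1 - t)) = f k powr t * (y powr (t - 1) * y powr (1 - t))"
      by simp
    also have "\<dots> = f k powr t" using \<open>0 < y\<close> by (simp flip: powr_add)
    finally show ?thesis .
  qed
  have "avg n (\<lambda>k. f k powr t) \<le> avg n (\<lambda>k. y powr (t - 1) * (t * f k + (1 - t) * y))"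
    by (intro avg_mono le)
  also have "\<dots> = y powr (t - 1) * (t * y + (1 - t) * y)"
    by (simp add: avg_cmult avg_add y_def)
  also have "\<dots> = y powr (t - 1) * y powr 1" using \<open>0 < y\<close> by (simp add: algebra_simps)
  also have "\<dots> = y powr t" by (subst powr_add [symmetric]) simp
  finally show ?thesis by (simp add: y_def)
qed

end

section \<open>The scale of the relative growth\<close>

text \<open>
  The bound on the relative growth of the mean. An exponent above \<open>1/2\<close> lets the Poincare
  inequality win against its factor \<open>n\<close>; an exponent below \<open>1\<close> leaves the factor
  \<open>q\<^sup>1\<^sup>-\<^sup>\<gamma> < 1\<close> that the induction for the mean lives on.
\<close>
definition decay :: "nat \<Rightarrow> real" where
  "decay n = real (Suc n) powr (- 3 / 4)"

lemma decay_eq: "decay n = 1 / real (Suc n) powr (3 / 4)"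
  by (simp add: decay_def powr_minus_divide)

lemma decay_pos: "decay n > 0"
  by (simp add: decay_def)

lemma decay_square: "(decay n)\<^sup>2 = real (Suc n) powr (- 3 / 2)"
  by (simp add: decay_def power2_eq_square flip: powr_add)

lemma antimono_decay: "antimono decay"
  unfolding decay_def antimono_iff_le_Suc by (auto intro!: powr_mono2')

lemma inverse_Suc_le_decay: "1 / real (Suc n) \<le> decay n"
proof -
  have "real (Suc n) powr (- 1) \<le> decay n" unfolding decay_def by (intro powr_mono) auto
  then show ?thesis by (simp add: powr_minus divide_inverse)
qed

lemma decay_Suc_ge: "(1 - 1 / (real n + 2)) * decay n \<le> decay (Suc n)"
proof -
  let ?r = "(real n + 1) / (real n + 2)"
  have "?r powr 1 \<le> ?r powr (3 / 4)" by (intro powr_mono') auto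
  also have "\<dots> = (real n + 1) powr (3 / 4) / (real n + 2) powr (3 / 4)"
    by (rule powr_divide)
  also have "\<dots> = decay (Suc n) / decay n"
    by (simp add: decay_eq add_ac)
  finally have "?r \<le> decay (Suc n) / decay n" by simp
  moreover have "1 - 1 / (real n + 2) = ?r" by (simp add: field_simps)
  ultimately show ?thesis using decay_pos[of n] by (simp add: pos_le_divide_eq)
qed

lemma Suc_times_decay_square: "real (Suc n) * (decay n)\<^sup>2 = 1 / sqrt (real (Suc n))"
proof -
  have "real (Suc n) * (decay n)\<^sup>2 = real (Suc n) powr 1 * real (Suc n) powr (- 3 / 2)"
    by (simp add: decay_square)
  also have "\<dots> = real (Suc n) powr (- (1 / 2))" by (subst powr_add [symmetric]) simp
  also have "\<dots> = 1 / sqrt (real (Suc n))"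
    by (subst powr_minus_divide) (simp add: powr_half_sqrt)
  finally show ?thesis .
qed

lemma inverse_sqrt_le_Suc:
  assumes "n \<ge> 1"
  shows "1 / sqrt (real n) \<le> 2 / sqrt (real (Suc n))"
proof -
  have "sqrt (real (Suc n)) \<le> sqrt (4 * real n)" using assms by (intro real_sqrt_le_mono) auto
  then have "sqrt (real (Suc n)) \<le> 2 * sqrt (real n)" by (simp add: real_sqrt_mult)
  then show ?thesis using assms by (simp add: field_simps)
qed

lemma sqrt_Suc_diff_ge: "1 / (2 * sqrt (real (Suc n))) \<le> sqrt (real (Suc n)) - sqrt (real n)"
proof -
  let ?x = "sqrt (real (Suc n))" and ?y = "sqrt (real n)"
  have "0 < ?x" "?y \<le> ?x" by auto
  have "1 = ?x\<^sup>2 - ?y\<^sup>2" by simp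
  also have "\<dots> = (?x - ?y) * (?x + ?y)" by (simp add: power2_eq_square algebra_simps)
  also have "\<dots> \<le> (?x - ?y) * (2 * ?x)" using \<open>?y \<le> ?x\<close> by (intro mult_left_mono) auto
  finally show ?thesis using \<open>0 < ?x\<close> by (simp add: pos_divide_le_eq mult_ac)
qed

lemma inverse_sqrt_Suc_tendsto_0: "(\<lambda>n. 1 / sqrt (real (Suc n))) \<longlonglongrightarrow> 0"
proof -
  have "filterlim (\<lambda>n. sqrt (real (Suc n))) at_top sequentially"
    by (intro filterlim_compose[OF sqrt_at_top] filterlim_compose[OF filterlim_real_sequentially]
        filterlim_Suc)
  then show ?thesis
    by (intro tendsto_divide_0[OF tendsto_const] filterlim_at_top_imp_at_infinity)
qed

lemma eventually_inverse_sqrt_small: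
  fixes K \<epsilon> :: real
  assumes "\<epsilon> > 0"
  obtains N where "\<And>n. n \<ge> N \<Longrightarrow> K / sqrt (real (Suc n)) \<le> \<epsilon>"
proof -
  have "(\<lambda>n. K * (1 / sqrt (real (Suc n)))) \<longlonglongrightarrow> K * 0"
    by (intro tendsto_mult tendsto_const inverse_sqrt_Suc_tendsto_0)
  then have "eventually (\<lambda>n. K * (1 / sqrt (real (Suc n))) < \<epsilon>) sequentially"
    using assms by (intro order_tendstoD) auto
  then obtain N where "\<And>n. n \<ge> N \<Longrightarrow> K * (1 / sqrt (real (Suc n))) < \<epsilon>"
    by (auto simp: eventually_sequentially)
  then show ?thesis by (intro that[of N]) (force intro: less_imp_le)
qed

context binomial_average
begin

text \<open>
  After multiplication by \<open>q\<close> the constant is the contraction factor \<open>q\<^sup>1\<^sup>/\<^sup>4\<close> of the induction in \<open>incr_le_decay_m\<close>.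
\<close>
lemma avg_decay: "avg n decay \<le> q powr (- 3 / 4) * decay n"
proof -
  have "avg n decay = avg n (\<lambda>k. (1 / real (Suc k)) powr (3 / 4))"
    by (simp add: decay_eq[abs_def] powr_divide)
  also have "\<dots> \<le> avg n (\<lambda>k. 1 / real (Suc k)) powr (3 / 4)"
    by (intro avg_powr_le) auto
  also have "\<dots> \<le> (1 / (real (Suc n) * q)) powr (3 / 4)"
    by (intro powr_mono2 avg_inverse_Suc avg_nonneg) auto
  also have "\<dots> = q powr (- 3 / 4) * decay n"
    using q_pos by (simp add: decay_eq powr_divide powr_mult powr_minus_divide)
  finally show ?thesis .
qed

lemma avg_decay_square:
  obtains K where "K > 0" "\<And>n. avg n (\<lambda>k. (decay k)\<^sup>2) \<le> K * (decay n)\<^sup>2"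
proof
  show "(2 / q\<^sup>2) powr (3 / 4) > 0" using q_pos by simp
  fix n
  have sq: "(decay k)\<^sup>2 = (1 / (real (Suc k))\<^sup>2) powr (3 / 4)" for k
  proof -
    have "(1 / (real (Suc k))\<^sup>2) = real (Suc k) powr (- 2)"
      by (simp add: powr_minus_divide)
    then show ?thesis unfolding decay_square by (simp add: powr_powr)
  qed
  have "avg n (\<lambda>k. (decay k)\<^sup>2) \<le> avg n (\<lambda>k. 1 / (real (Suc k))\<^sup>2) powr (3 / 4)"
    unfolding sq by (intro avg_powr_le) auto
  also have "\<dots> \<le> (2 / (real (Suc n) * q)\<^sup>2) powr (3 / 4)"
    by (intro powr_mono2 avg_inverse_square avg_nonneg) auto
  also have "2 / (real (Suc n) * q)\<^sup>2 = (2 / q\<^sup>2) * (1 / (real (Suc n))\<^sup>2)"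
    by (simp add: power_mult_distrib mult.commute del: of_nat_Suc)
  also have "\<dots> powr (3 / 4) = (2 / q\<^sup>2) powr (3 / 4) * (decay n)\<^sup>2"
    unfolding sq by (rule powr_mult) 
  finally show "avg n (\<lambda>k. (decay k)\<^sup>2) \<le> (2 / q\<^sup>2) powr (3 / 4) * (decay n)\<^sup>2" .
qed

end

section \<open>Growth of the mean and the variance\<close>

text \<open>
  The mean and the variance as deterministic sequences. The recurrence of the mean fails at the first
  step, where the increment is \<open>1\<close> although \<open>m 0 = 0\<close>; the variance sees no such exception, because
  both initial values are constants.
\<close>
locale moment_recurrence = binomial_average +
  fixes m V :: "nat \<Rightarrow> real"
  assumes m_0: "m 0 = 0" and m_1: "m 1 = 1"
    and m_Suc: "n \<ge> 1 \<Longrightarrow> m (Suc n) = m n + avg n m"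
    and V_0: "V 0 = 0"
    and V_Suc: "V (Suc n) = V n + avg n V + (avg n (\<lambda>k. (m k)\<^sup>2) - (avg n m)\<^sup>2)"
begin

definition incr :: "nat \<Rightarrow> real" where "incr n = m (Suc n) - m n"

text \<open>
  By \<open>avg_stein\<close> this is the coefficient of the linear regression of \<open>m\<close> on a binomial index with
  \<open>n + 1\<close> trials.
\<close>
definition slope :: "nat \<Rightarrow> real" where "slope n = avg n incr"

text \<open>
  A monotone substitute for \<open>incr\<close>, which drops from \<open>1\<close> to \<open>q\<close> at the first step and so is not
  admissible in the association inequality. The two agree up to the constant factor \<open>1 + 1 / q\<close>.
\<close>
definition incr_bound :: "nat \<Rightarrow> real" where "incr_bound n = avg n m + 1"

lemma incr_0: "incr 0 = 1"
  using m_0 m_1 by (simp add: incr_def)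

lemma incr_eq_avg: "n \<ge> 1 \<Longrightarrow> incr n = avg n m"
  by (simp add: incr_def m_Suc)

lemma m_nonneg: "0 \<le> m n"
proof (induction n rule: less_induct)
  case (less n)
  show ?case
  proof (cases "n \<le> 1")
    case True
    then show ?thesis using m_0 m_1 by (cases n) auto
  next
    case False
    then obtain j where j: "n = Suc j" "j \<ge> 1" by (cases n) auto
    then have "0 \<le> avg j m" using less by (intro avg_nonneg) auto
    then show ?thesis using m_Suc[of j] j less[of j] by simp
  qed
qed

lemma incr_nonneg: "0 \<le> incr n"
  using incr_0 incr_eq_avg[of n] avg_nonneg[of n m] m_nonneg by (cases n) auto

lemma mono_m: "mono m"
  using incr_nonneg by (simp add: incr_def mono_iff_le_Suc)

lemma slope_nonneg: "0 \<le> slope n"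
  unfolding slope_def by (intro avg_nonneg incr_nonneg)

lemma incr_bound_Suc: "incr_bound (Suc n) = incr_bound n + q * slope n"
  using avg_Suc_diff[of n m] by (simp add: incr_bound_def slope_def incr_def[abs_def])

lemma mono_incr_bound: "mono incr_bound"
  using slope_nonneg q_pos by (simp add: mono_iff_le_Suc incr_bound_Suc)

lemma incr_bound_0: "incr_bound 0 = 1"
  using m_0 by (simp add: incr_bound_def)

lemma incr_bound_ge_1: "1 \<le> incr_bound n"
  using mono_incr_bound incr_bound_0 by (metis monoD zero_le)

lemma incr_le_incr_bound: "incr n \<le> incr_bound n"
  using incr_0 incr_bound_0 incr_eq_avg[of n] by (cases n) (auto simp: incr_bound_def)

lemma incr_ge: "q \<le> incr n"
proof (cases "n = 0")
  case True
  then show ?thesis using incr_0 q_less_1 by simp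
next
  case False
  have "avg 1 m = q" using m_0 m_1 by (simp add: avg_Suc)
  moreover have "avg 1 m \<le> avg n m" using avg_mono_index[OF mono_m] False by (auto simp: mono_def)
  ultimately show ?thesis using incr_eq_avg False by simp
qed

lemma incr_bound_le_incr: "incr_bound n \<le> (1 + 1 / q) * incr n"
proof -
  have "1 \<le> incr n / q" using incr_ge[of n] q_pos by simp
  moreover have "avg n m \<le> incr n" using incr_nonneg[of 0] m_0 incr_eq_avg[of n] by (cases n) auto
  ultimately show ?thesis by (simp add: incr_bound_def algebra_simps)
qed

lemma slope_ge: "q \<le> slope n"
  using avg_mono[of n "\<lambda>_. q" incr] incr_ge by (simp add: slope_def)

lemma slope_le_avg_incr_bound: "slope n \<le> avg n incr_bound"
  unfolding slope_def by (intro avg_mono incr_le_incr_bound)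

lemma slope_le_incr_bound: "slope n \<le> incr_bound n"
  using slope_le_avg_incr_bound[of n] avg_le_top[OF mono_incr_bound, of n] by simp

lemma avg_incr_bound_le_slope: "avg n incr_bound \<le> (1 + 1 / q) * slope n"
  using avg_mono[of n incr_bound "\<lambda>k. (1 + 1 / q) * incr k"] incr_bound_le_incr by (simp add: avg_cmult slope_def)

lemma incr_bound_Suc_le: "incr_bound (Suc n) \<le> 2 * incr_bound n"
proof -
  have "q * slope n \<le> 1 * incr_bound n"
    using slope_le_incr_bound[of n] slope_nonneg[of n] q_pos q_less_1 by (intro mult_mono) auto
  then show ?thesis using incr_bound_Suc[of n] by simp
qed

lemma slope_Suc_le: "slope (Suc n) \<le> 2 * (1 + 1 / q) * slope n"
proof -
  have "slope (Suc n) \<le> (1 - q) * avg n incr_bound + q * avg n (\<lambda>k. incr_bound (Suc k))"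
    using slope_le_avg_incr_bound[of "Suc n"] by (simp add: avg_Suc)
  also have "avg n (\<lambda>k. incr_bound (Suc k)) \<le> 2 * avg n incr_bound"
    using avg_mono[of n "\<lambda>k. incr_bound (Suc k)" "\<lambda>k. 2 * incr_bound k"] incr_bound_Suc_le by (simp add: avg_cmult)
  then have "(1 - q) * avg n incr_bound + q * avg n (\<lambda>k. incr_bound (Suc k)) \<le> (1 - q) * (2 * avg n incr_bound) + q * (2 * avg n incr_bound)"
    using q_pos q_less_1 slope_le_avg_incr_bound[of n] slope_nonneg[of n]
    by (intro add_mono mult_left_mono) auto
  also have "\<dots> = 2 * avg n incr_bound" by (simp add: algebra_simps)
  also have "\<dots> \<le> 2 * ((1 + 1 / q) * slope n)" using avg_incr_bound_le_slope[of n] by simp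
  finally show ?thesis by (simp only: mult.assoc)
qed

lemma incr_diff_le_slope: "\<bar>incr (Suc k) - incr k\<bar> \<le> slope k"
proof (cases "k = 0")
  case True
  then show ?thesis using incr_0 incr_nonneg[of 1] incr_le_incr_bound[of 1] incr_bound_Suc[of 0] incr_bound_0 q_less_1 incr_eq_avg[of 1]
    by (auto simp: slope_def incr_bound_def)
next
  case False
  then have "incr (Suc k) - incr k = q * slope k"
    using avg_Suc_diff[of k m] by (simp add: incr_eq_avg) (simp add: slope_def incr_def[abs_def])
  then show ?thesis using q_pos q_less_1 slope_nonneg[of k] by (simp add: abs_mult mult_left_le_one_le)
qed

text \<open>
  If \<open>\<lambda> = d / x\<close> is the relative growth of a sequence with value \<open>x\<close> and increment \<open>d\<close>, and the
  increments grow at the relative rate \<open>\<rho> \<Phi>\<close>, then the next relative growth is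
  \<open>(1 + \<rho> \<Phi>) \<lambda> / (1 + \<lambda>)\<close>. This increases with \<open>\<lambda>\<close>, hence \<open>\<lambda> \<le> \<Phi>\<close> may be inserted.
\<close>
lemma relative_growth_step:
  fixes \<Phi> \<Phi>' \<rho> d x :: real
  assumes "d \<ge> 0" "d \<le> \<Phi> * x" "x \<ge> 0" "\<Phi>' \<ge> 0" "(1 + \<rho> * \<Phi>) * \<Phi> \<le> \<Phi>' * (1 + \<Phi>)"
  shows "(1 + \<rho> * \<Phi>) * d \<le> \<Phi>' * (x + d)"
proof (cases "1 + \<rho> * \<Phi> \<le> \<Phi>'")
  case True
  then have "(1 + \<rho> * \<Phi>) * d \<le> \<Phi>' * d" using assms by (intro mult_right_mono)
  also have "\<dots> \<le> \<Phi>' * (x + d)" using assms by (intro mult_left_mono) auto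
  finally show ?thesis .
next
  case False
  then have "(1 + \<rho> * \<Phi> - \<Phi>') * d \<le> (1 + \<rho> * \<Phi> - \<Phi>') * (\<Phi> * x)"
    using assms by (intro mult_left_mono) auto
  also have "\<dots> = ((1 + \<rho> * \<Phi>) * \<Phi> - \<Phi>' * \<Phi>) * x" by (simp add: algebra_simps)
  also have "\<dots> \<le> \<Phi>' * x" using assms by (intro mult_right_mono) (auto simp: algebra_simps)
  finally show ?thesis by (simp add: algebra_simps)
qed

text \<open>
  The heart of the matter. If the bound holds up to \<open>n\<close>, the increment of \<open>incr\<close> at \<open>n\<close> is \<open>q\<close> times
  an average of terms below \<open>C decay (m + c)\<close>. By association this is at most \<open>\<rho> C decay n\<close> times
  \<open>incr n\<close>, with a factor \<open>\<rho>\<close> below \<open>1\<close>. The relative growth of \<open>m\<close> is thereby pulled below the slowly decreasing bound again.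
  The shift \<open>c\<close> makes the ratio finite at \<open>0\<close>, where \<open>m\<close> vanishes; it has to be small, since it
  inflates the contraction factor \<open>q\<^sup>1\<^sup>/\<^sup>4\<close> to \<open>q\<^sup>1\<^sup>/\<^sup>4 (1 + c / q)\<close>.
\<close>
lemma incr_le_decay_m:
  obtains c C where "c > 0" "C > 0" "\<And>n. incr n \<le> C * decay n * (m n + c)"
proof -
  define \<theta> where "\<theta> = q powr (1 / 4)"
  have \<theta>: "0 < \<theta>" "\<theta> < 1" using q_pos q_less_1 powr_less_mono2[of "1/4" q 1] by (auto simp: \<theta>_def)
  \<comment> \<open>With this shift the inflated factor is the midpoint of \<open>\<theta>\<close> and \<open>1\<close>.\<close>
  define c where "c = q * (1 / \<theta> - 1) / 2"
  define \<rho> where "\<rho> = (1 + \<theta>) / 2"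
  have c: "c > 0" using \<theta> q_pos by (simp add: c_def)
  have \<rho>: "\<rho> < 1" "\<theta> * (1 + c / q) = \<rho>" using \<theta> q_pos by (auto simp: \<rho>_def c_def field_simps)
  define N where "N = Suc (nat \<lceil>2 / (1 - \<rho>)\<rceil>)"
  \<comment> \<open>The three summands serve the index \<open>0\<close>, the indices up to \<open>N\<close> and the induction step.\<close>
  define C where "C = 1 / c + (real N + 1) + 2 / (1 - \<rho>)"
  have C: "C \<ge> 1 / c" "C \<ge> real N + 1" "C \<ge> 2 / (1 - \<rho>)" "C > 0"
    using c \<rho> unfolding C_def by (auto intro!: add_nonneg_nonneg add_pos_nonneg)
  have large_n: "(1 + \<rho> * (C * decay n)) * (C * decay n) \<le> (C * decay (Suc n)) * (1 + C * decay n)"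
    if n: "n \<ge> N" for n
  proof -
    let ?f = "C * decay n"
    have f: "?f > 0" using C decay_pos by simp
    have "2 / (1 - \<rho>) \<le> real N" unfolding N_def by linarith
    also have "\<dots> \<le> real n + 2" using n by simp
    finally have 1: "2 \<le> (1 - \<rho>) * (real n + 2)" using \<rho> by (simp add: field_simps)
    have "1 \<le> decay n * real (Suc n)" using inverse_Suc_le_decay[of n] by (simp add: field_simps)
    also have "\<dots> \<le> decay n * (real n + 2)" using decay_pos[of n] by (intro mult_left_mono) auto
    finally have "1 \<le> decay n * (real n + 2)" .
    then have "2 / (1 - \<rho>) * 1 \<le> C * (decay n * (real n + 2))"
      using C \<rho> by (intro mult_mono) auto
    then have 2: "2 \<le> (1 - \<rho>) * (real n + 2) * ?f" using \<rho> by (simp add: field_simps)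
    have 3: "2 * ?f \<le> (1 - \<rho>) * (real n + 2) * ?f" using 1 f by (intro mult_right_mono) auto
    have "1 + ?f \<le> (real n + 2) * ((1 - \<rho>) * ?f)" using 2 3 by (simp add: algebra_simps)
    then have "(1 + ?f) / (real n + 2) \<le> (1 - \<rho>) * ?f"
      by (simp add: pos_divide_le_eq mult_ac)
    then have "1 + \<rho> * ?f \<le> (1 - 1 / (real n + 2)) * (1 + ?f)"
      by (simp add: algebra_simps add_divide_distrib)
    then have "(1 + \<rho> * ?f) * ?f \<le> (1 - 1 / (real n + 2)) * (1 + ?f) * ?f"
      using f by (intro mult_right_mono) auto
    also have "\<dots> = C * ((1 - 1 / (real n + 2)) * decay n) * (1 + ?f)" by simp
    also have "\<dots> \<le> C * decay (Suc n) * (1 + ?f)"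
      using decay_Suc_ge C f by (intro mult_right_mono mult_left_mono) auto
    finally show ?thesis .
  qed
  have "incr n \<le> C * decay n * (m n + c)" for n
  proof (induction n rule: less_induct)
    case (less n)
    consider "n = 0" | "1 \<le> n" "n \<le> N" | "n > N" by linarith
    then show ?case
    proof cases
      case 1
      then show ?thesis using C c incr_0 m_0 by (simp add: decay_def field_simps)
    next
      case 2
      have "incr n \<le> m n" using 2 incr_eq_avg avg_le_top[OF mono_m] by simp
      also have "\<dots> \<le> 1 * (m n + c)" using c by simp
      also have "\<dots> \<le> C * decay n * (m n + c)"
      proof (intro mult_right_mono)
        have "1 = real (Suc n) * (1 / real (Suc n))" by simp
        also have "\<dots> \<le> C * decay n"
          using 2 C inverse_Suc_le_decay[of n] by (intro mult_mono) auto
        finally show "1 \<le> C * decay n" .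
      qed (use c m_nonneg[of n] in auto)
      finally show ?thesis .
    next
      case 3
      then obtain j where j: "n = Suc j" "j \<ge> 1" "j \<ge> N" by (cases n) (auto simp: N_def)
      have mono_mc: "mono (\<lambda>k. m k + c)" using mono_m by (auto simp: mono_def)
      have anti: "antimono (\<lambda>k. C * decay k)"
        using antimono_decay C by (auto simp: antimono_def)
      have "incr (Suc j) - incr j = q * avg j incr"
        using avg_Suc_diff[of j m] j by (simp add: incr_eq_avg) (simp add: incr_def[abs_def])
      also have "avg j incr \<le> avg j (\<lambda>k. C * decay k * (m k + c))"
        using less j by (intro avg_mono) auto
      also have "\<dots> \<le> avg j (\<lambda>k. C * decay k) * avg j (\<lambda>k. m k + c)"
        by (intro avg_chebyshev anti mono_mc)
      also have "\<dots> \<le> C * (q powr (- 3 / 4) * decay j) * (incr j + c)"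
        using avg_decay[of j] C c incr_nonneg[of j] j
        by (auto simp: avg_cmult avg_add incr_eq_avg intro!: mult_mono)
      also have "q * (C * (q powr (- 3 / 4) * decay j) * (incr j + c)) = (q powr 1 * q powr (- 3 / 4)) * (C * decay j) * (incr j + c)"
        using q_pos by simp
      also have "q powr 1 * q powr (- 3 / 4) = \<theta>"
        unfolding \<theta>_def by (subst powr_add [symmetric]) simp
      finally have *: "incr (Suc j) - incr j \<le> \<theta> * (C * decay j) * (incr j + c)" using q_pos by simp
      have "c \<le> c / q * incr j" using incr_ge[of j] c q_pos by (simp add: field_simps)
      then have "\<theta> * (C * decay j) * (incr j + c) \<le> \<theta> * (C * decay j) * ((1 + c / q) * incr j)"
        using \<theta> C decay_pos[of j] by (intro mult_left_mono) (auto simp: algebra_simps)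
      also have "\<dots> = \<theta> * (1 + c / q) * (C * decay j) * incr j" by (simp only: mult_ac)
      also have "\<dots> = \<rho> * (C * decay j) * incr j" by (simp only: \<rho>)
      finally have "incr (Suc j) \<le> (1 + \<rho> * (C * decay j)) * incr j" using * by (simp add: algebra_simps)
      also have "\<dots> \<le> C * decay (Suc j) * ((m j + c) + incr j)"
      proof (rule relative_growth_step)
        show "incr j \<le> C * decay j * (m j + c)" using less j by simp
        show "0 \<le> m j + c" using m_nonneg[of j] c by simp
        show "0 \<le> C * decay (Suc j)" using C decay_pos[of "Suc j"] by simp
      qed (use incr_nonneg large_n j in auto)
      finally show ?thesis using j by (simp add: incr_def algebra_simps)
    qed
  qed
  then show ?thesis using that c C by blast
qed

text \<open>
  The growth bound passes through one more average.
\<close>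
lemma slope_le_decay_incr:
  obtains K where "K > 0" "\<And>n. slope n \<le> K * decay n * incr n"
proof -
  obtain c C where c: "c > 0" "C > 0" and incr: "\<And>n. incr n \<le> C * decay n * (m n + c)"
    by (rule incr_le_decay_m) blast
  have mono_mc: "mono (\<lambda>k. m k + c)" using mono_m by (auto simp: mono_def)
  have anti: "antimono (\<lambda>k. C * decay k)" using antimono_decay c by (auto simp: antimono_def)
  show ?thesis
  proof
    show "C * q powr (- 3 / 4) * (1 + c / q) > 0" using c q_pos by (simp add: add_pos_pos)
    fix n
    have "slope n \<le> avg n (\<lambda>k. C * decay k * (m k + c))"
      unfolding slope_def by (intro avg_mono incr)
    also have "\<dots> \<le> avg n (\<lambda>k. C * decay k) * avg n (\<lambda>k. m k + c)"
      by (intro avg_chebyshev anti mono_mc)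
    also have "\<dots> \<le> (C * (q powr (- 3 / 4) * decay n)) * ((1 + c / q) * incr n)"
    proof (intro mult_mono)
      show "avg n (\<lambda>k. C * decay k) \<le> C * (q powr (- 3 / 4) * decay n)"
        using avg_decay[of n] c by (simp add: avg_cmult)
      have "avg n m \<le> incr n" using incr_nonneg[of 0] m_0 incr_eq_avg[of n] by (cases n) auto
      moreover have "c \<le> c / q * incr n" using incr_ge[of n] c q_pos by (simp add: field_simps)
      ultimately show "avg n (\<lambda>k. m k + c) \<le> (1 + c / q) * incr n"
        by (simp add: avg_add algebra_simps)
      show "0 \<le> C * (q powr (- 3 / 4) * decay n)" using c decay_pos[of n] by simp
      show "0 \<le> avg n (\<lambda>k. m k + c)" using m_nonneg c by (intro avg_nonneg) (auto intro: add_nonneg_nonneg)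
    qed
    finally show "slope n \<le> C * q powr (- 3 / 4) * (1 + c / q) * decay n * incr n"
      by (simp add: mult_ac)
  qed
qed

lemma mono_incr_bound_square: "mono (\<lambda>k. (incr_bound k)\<^sup>2)"
  using mono_incr_bound incr_bound_ge_1 unfolding mono_def by (meson order_trans power_mono zero_le_one)

lemma avg_incr_bound_square_le: "avg n (\<lambda>k. (incr_bound k)\<^sup>2) \<le> (1 + 1 / q)\<^sup>2 * avg n (\<lambda>k. (incr k)\<^sup>2)"
proof -
  have "avg n (\<lambda>k. (incr_bound k)\<^sup>2) \<le> avg n (\<lambda>k. (1 + 1 / q)\<^sup>2 * (incr k)\<^sup>2)"
  proof (intro avg_mono)
    fix k
    have "(incr_bound k)\<^sup>2 \<le> ((1 + 1 / q) * incr k)\<^sup>2" using incr_bound_le_incr[of k] incr_bound_ge_1[of k] by (intro power_mono) auto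
    then show "(incr_bound k)\<^sup>2 \<le> (1 + 1 / q)\<^sup>2 * (incr k)\<^sup>2" by (simp add: power_mult_distrib)
  qed
  then show ?thesis by (simp only: avg_cmult)
qed

text \<open>
  Since \<open>decay\<^sup>2\<close> is \<open>n\<^sup>-\<^sup>3\<^sup>/\<^sup>2\<close>, this average stays small even after multiplication by the factor \<open>n\<close>
  of the Poincare inequality.
\<close>
lemma avg_slope_square_le:
  obtains K where "K > 0"
    "\<And>n. avg n (\<lambda>k. (slope k)\<^sup>2) \<le> K * (decay n)\<^sup>2 * avg n (\<lambda>k. (incr_bound k)\<^sup>2)"
proof -
  obtain K1 where K1: "K1 > 0" "\<And>n. slope n \<le> K1 * decay n * incr n" by (rule slope_le_decay_incr) blast
  obtain K2 where K2: "K2 > 0" "\<And>n. avg n (\<lambda>k. (decay k)\<^sup>2) \<le> K2 * (decay n)\<^sup>2"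
    by (rule avg_decay_square) blast
  have anti: "antimono (\<lambda>k. (decay k)\<^sup>2)"
    using antimono_decay decay_pos unfolding antimono_def by (meson less_imp_le power_mono)
  show ?thesis
  proof
    show "K1\<^sup>2 * K2 > 0" using K1 K2 by simp
    fix n
    have "avg n (\<lambda>k. (slope k)\<^sup>2) \<le> avg n (\<lambda>k. K1\<^sup>2 * ((decay k)\<^sup>2 * (incr_bound k)\<^sup>2))"
    proof (intro avg_mono)
      fix k
      have "K1 * decay k * incr k \<le> K1 * decay k * incr_bound k"
        using K1 decay_pos[of k] incr_le_incr_bound by (intro mult_left_mono) auto
      then have "slope k \<le> K1 * decay k * incr_bound k" using K1(2)[of k] by linarith
      then have "(slope k)\<^sup>2 \<le> (K1 * decay k * incr_bound k)\<^sup>2" using slope_nonneg by (intro power_mono)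
      then show "(slope k)\<^sup>2 \<le> K1\<^sup>2 * ((decay k)\<^sup>2 * (incr_bound k)\<^sup>2)" by (simp add: power_mult_distrib mult_ac)
    qed
    also have "\<dots> = K1\<^sup>2 * avg n (\<lambda>k. (decay k)\<^sup>2 * (incr_bound k)\<^sup>2)" by (rule avg_cmult)
    also have "\<dots> \<le> K1\<^sup>2 * (avg n (\<lambda>k. (decay k)\<^sup>2) * avg n (\<lambda>k. (incr_bound k)\<^sup>2))"
      by (intro mult_left_mono avg_chebyshev anti mono_incr_bound_square) auto
    also have "\<dots> \<le> K1\<^sup>2 * ((K2 * (decay n)\<^sup>2) * avg n (\<lambda>k. (incr_bound k)\<^sup>2))"
      using K2 by (intro mult_left_mono mult_right_mono avg_nonneg) auto
    finally show "avg n (\<lambda>k. (slope k)\<^sup>2) \<le> K1\<^sup>2 * K2 * (decay n)\<^sup>2 * avg n (\<lambda>k. (incr_bound k)\<^sup>2)"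
      by (simp add: mult_ac)
  qed
qed

text \<open>
  The Poincare inequality applied to \<open>incr\<close>, whose differences are bounded by \<open>slope\<close>.
\<close>
lemma incr_variance_le_second_moment:
  obtains K where "K > 0"
    "\<And>n. avg n (\<lambda>k. (incr k)\<^sup>2) - (slope n)\<^sup>2 \<le> K / sqrt (real (Suc n)) * avg n (\<lambda>k. (incr k)\<^sup>2)"
proof -
  obtain K where K: "K > 0"
    "\<And>n. avg n (\<lambda>k. (slope k)\<^sup>2) \<le> K * (decay n)\<^sup>2 * avg n (\<lambda>k. (incr_bound k)\<^sup>2)"
    by (rule avg_slope_square_le) blast
  have "0 < 1 + 1 / q" using q_pos by (simp add: add_pos_pos)
  then have K': "0 < 2 * K * (1 + 1 / q)\<^sup>2" using K by simp
  show ?thesis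
  proof (rule that[OF K'])
    fix n
    show "avg n (\<lambda>k. (incr k)\<^sup>2) - (slope n)\<^sup>2
      \<le> (2 * K * (1 + 1 / q)\<^sup>2) / sqrt (real (Suc n)) * avg n (\<lambda>k. (incr k)\<^sup>2)"
    proof (cases n)
      case 0
      then show ?thesis using K by (simp add: slope_def)
    next
      case (Suc j)
      let ?F = "avg n (\<lambda>k. (incr_bound k)\<^sup>2)"
      have "avg n (\<lambda>k. (incr k)\<^sup>2) - (slope n)\<^sup>2
          \<le> real n * (q * (1 - q)) * avg j (\<lambda>k. (incr (Suc k) - incr k)\<^sup>2)"
        using avg_poincare[of n incr] Suc by (simp add: slope_def mult_ac)
      also have "\<dots> \<le> real n * 1 * avg j (\<lambda>k. (slope k)\<^sup>2)"
      proof (intro mult_mono avg_mono)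
        show "q * (1 - q) \<le> 1" using mult_mono[of q 1 "1 - q" 1] q_pos q_less_1 by simp
        show "(incr (Suc k) - incr k)\<^sup>2 \<le> (slope k)\<^sup>2" for k
          using incr_diff_le_slope[of k] by (simp add: abs_le_square_iff [symmetric] slope_nonneg)
      qed (use q_pos q_less_1 in \<open>auto intro!: avg_nonneg\<close>)
      also have "\<dots> \<le> real n * (K * (decay j)\<^sup>2 * avg j (\<lambda>k. (incr_bound k)\<^sup>2))"
        using K(2)[of j] by (simp add: mult_left_mono)
      also have "\<dots> \<le> real n * (K * (decay j)\<^sup>2 * ?F)"
        using K avg_mono_index[OF mono_incr_bound_square] Suc
        by (intro mult_left_mono) (auto simp: mono_def)
      also have "\<dots> = K * (real (Suc j) * (decay j)\<^sup>2) * ?F"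
        using Suc by simp
      also have "\<dots> = K * (1 / sqrt (real n)) * ?F"
        unfolding Suc_times_decay_square Suc ..
      also have "\<dots> \<le> K * (2 / sqrt (real (Suc n))) * ((1 + 1 / q)\<^sup>2 * avg n (\<lambda>k. (incr k)\<^sup>2))"
        using inverse_sqrt_le_Suc[of n] Suc K
        by (intro mult_mono avg_incr_bound_square_le mult_left_mono avg_nonneg) auto
      finally show ?thesis by (simp add: mult_ac)
    qed
  qed
qed

text \<open>
  A reversed Jensen inequality. For large \<open>n\<close> the variance of \<open>incr\<close> takes up at most half of its second
  moment, so that the squared mean makes up the other half; for small \<open>n\<close> both sides are bounded
  away from \<open>0\<close> and \<open>\<infinity>\<close>.
\<close>
lemma avg_incr_bound_square_le_slope:
  obtains K where "K > 0" "\<And>n. avg n (\<lambda>k. (incr_bound k)\<^sup>2) \<le> K * (slope n)\<^sup>2"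
proof -
  obtain K where K: "K > 0"
    "\<And>n. avg n (\<lambda>k. (incr k)\<^sup>2) - (slope n)\<^sup>2 \<le> K / sqrt (real (Suc n)) * avg n (\<lambda>k. (incr k)\<^sup>2)"
    by (rule incr_variance_le_second_moment) blast
  obtain N where N: "\<And>n. n \<ge> N \<Longrightarrow> K / sqrt (real (Suc n)) \<le> 1 / 2"
    by (rule eventually_inverse_sqrt_small[of "1/2" K]) auto
  define M where "M = avg N (\<lambda>k. (incr_bound k)\<^sup>2) / q\<^sup>2"
  define K' where "K' = 2 * (1 + 1 / q)\<^sup>2 + M"
  have M: "0 \<le> M" unfolding M_def by (intro divide_nonneg_nonneg avg_nonneg) auto
  have "0 < 1 + 1 / q" using q_pos by (simp add: add_pos_pos)
  then have pos: "0 < 2 * (1 + 1 / q)\<^sup>2" by simp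
  show ?thesis
  proof
    show "K' > 0" unfolding K'_def using M pos by linarith
    fix n
    show "avg n (\<lambda>k. (incr_bound k)\<^sup>2) \<le> K' * (slope n)\<^sup>2"
    proof (cases "n \<ge> N")
      case True
      let ?D2 = "avg n (\<lambda>k. (incr k)\<^sup>2)"
      have "K / sqrt (real (Suc n)) * ?D2 \<le> 1 / 2 * ?D2"
        by (intro mult_right_mono N True avg_nonneg) auto
      then have "?D2 - (slope n)\<^sup>2 \<le> 1 / 2 * ?D2" using K(2)[of n] by linarith
      then have "?D2 \<le> 2 * (slope n)\<^sup>2" by simp
      then have "(1 + 1 / q)\<^sup>2 * ?D2 \<le> (1 + 1 / q)\<^sup>2 * (2 * (slope n)\<^sup>2)" by (intro mult_left_mono) auto
      also have "\<dots> \<le> K' * (slope n)\<^sup>2" using M by (simp add: K'_def algebra_simps)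
      finally show ?thesis using avg_incr_bound_square_le[of n] by simp
    next
      case False
      then have "avg n (\<lambda>k. (incr_bound k)\<^sup>2) \<le> avg N (\<lambda>k. (incr_bound k)\<^sup>2)"
        using avg_mono_index[OF mono_incr_bound_square] by (auto simp: mono_def)
      also have "\<dots> = M * q\<^sup>2" using q_pos by (simp add: M_def)
      also have "\<dots> \<le> K' * (slope n)\<^sup>2"
        using M pos slope_ge[of n] q_pos by (intro mult_mono power_mono) (auto simp: K'_def)
      finally show ?thesis .
    qed
  qed
qed

text \<open>
  The variance of the linear regression of \<open>m\<close> on a binomial index with \<open>n + 1\<close> trials.
\<close>
definition lin_var :: "nat \<Rightarrow> real" where
  "lin_var n = real (Suc n) * (q * (1 - q)) * (slope n)\<^sup>2"

lemma lin_var_ge: "real (Suc n) * (q * (1 - q) * q\<^sup>2) \<le> lin_var n"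
proof -
  have "real (Suc n) * (q * (1 - q)) * q\<^sup>2 \<le> lin_var n"
    unfolding lin_var_def using q_pos q_less_1 slope_ge[of n] by (intro mult_left_mono power_mono) auto
  then show ?thesis by (simp add: mult_ac)
qed

lemma lin_var_pos: "0 < lin_var n"
proof -
  have "0 < real (Suc n) * (q * (1 - q) * q\<^sup>2)" using q_pos q_less_1 by simp
  then show ?thesis using lin_var_ge[of n] by linarith
qed

text \<open>
  The left-hand side is the variance of \<open>m\<close> at the random index that the linear regression leaves
  unexplained. It is controlled by the variance of \<open>incr\<close>, through the Poincare inequality for \<open>m\<close>.
\<close>
lemma index_variance_le:
  obtains K where "K > 0"
    "\<And>n. avg (Suc n) (\<lambda>k. (m k)\<^sup>2) - (avg (Suc n) m)\<^sup>2 - lin_var n \<le> K / sqrt (real (Suc n)) * lin_var n"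
proof -
  obtain K where K: "K > 0"
    "\<And>n. avg n (\<lambda>k. (incr k)\<^sup>2) - (slope n)\<^sup>2 \<le> K / sqrt (real (Suc n)) * avg n (\<lambda>k. (incr k)\<^sup>2)"
    by (rule incr_variance_le_second_moment) blast
  obtain L where L: "L > 0" "\<And>n. avg n (\<lambda>k. (incr_bound k)\<^sup>2) \<le> L * (slope n)\<^sup>2"
    by (rule avg_incr_bound_square_le_slope) blast
  show ?thesis
  proof
    show "K * L > 0" using K L by simp
    fix n
    have "avg n (\<lambda>k. (incr k)\<^sup>2) \<le> avg n (\<lambda>k. (incr_bound k)\<^sup>2)"
      using incr_le_incr_bound incr_nonneg by (intro avg_mono power_mono) auto
    also note L(2)[of n]
    finally have "K / sqrt (real (Suc n)) * avg n (\<lambda>k. (incr k)\<^sup>2) \<le> K / sqrt (real (Suc n)) * (L * (slope n)\<^sup>2)"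
      using K by (intro mult_left_mono) auto
    with K(2)[of n] have *: "avg n (\<lambda>k. (incr k)\<^sup>2) - (slope n)\<^sup>2 \<le> K / sqrt (real (Suc n)) * (L * (slope n)\<^sup>2)"
      by linarith
    have "avg (Suc n) (\<lambda>k. (m k)\<^sup>2) - (avg (Suc n) m)\<^sup>2 - lin_var n
        \<le> real (Suc n) * (q * (1 - q)) * (avg n (\<lambda>k. (incr k)\<^sup>2) - (slope n)\<^sup>2)"
      using avg_poincare[of "Suc n" m] by (simp add: lin_var_def incr_def algebra_simps)
    also have "\<dots> \<le> real (Suc n) * (q * (1 - q)) * (K / sqrt (real (Suc n)) * (L * (slope n)\<^sup>2))"
      using * q_pos q_less_1 by (intro mult_left_mono) auto
    finally show "avg (Suc n) (\<lambda>k. (m k)\<^sup>2) - (avg (Suc n) m)\<^sup>2 - lin_var n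
        \<le> K * L / sqrt (real (Suc n)) * lin_var n"
      by (simp add: lin_var_def mult_ac)
  qed
qed

lemma V_nonneg: "0 \<le> V n"
proof (induction n rule: less_induct)
  case (less n)
  show ?case
  proof (cases n)
    case (Suc j)
    have "0 \<le> avg j V" using less Suc by (intro avg_nonneg) auto
    then show ?thesis using less[of j] Suc V_Suc[of j] avg_jensen_square[of j m] by simp
  qed (simp add: V_0)
qed

text \<open>
  By induction over the recurrence of the variance. The variance of the mean at the random index adds at
  most a multiple of \<open>n\<^sup>-\<^sup>1\<^sup>/\<^sup>2 (incr_bound n)\<^sup>2\<close>, which is what the growth of \<open>\<surd>n\<close> can absorb. The
  average of earlier variances adds only \<open>O(C n\<^sup>-\<^sup>1) (incr_bound n)\<^sup>2\<close>; its factor \<open>C\<close> is harmless because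
  \<open>n\<^sup>-\<^sup>1\<close> is of smaller order than \<open>n\<^sup>-\<^sup>1\<^sup>/\<^sup>2\<close>.
\<close>
lemma V_le:
  obtains C where "C > 0" "\<And>n. V n \<le> C * sqrt (real n) * (incr_bound n)\<^sup>2"
proof -
  obtain K where K: "K > 0" "\<And>n. slope n \<le> K * decay n * incr n" by (rule slope_le_decay_incr) blast
  obtain L where L: "L > 0" "\<And>n. avg n (\<lambda>k. (incr_bound k)\<^sup>2) \<le> L * (slope n)\<^sup>2"
    by (rule avg_incr_bound_square_le_slope) blast
  define K1 where "K1 = L * K\<^sup>2"
  have K1: "K1 > 0" using K L by (simp add: K1_def)
  have E2: "avg n (\<lambda>k. (incr_bound k)\<^sup>2) \<le> K1 * (decay n)\<^sup>2 * (incr_bound n)\<^sup>2" for n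
  proof -
    have "K * decay n * incr n \<le> K * decay n * incr_bound n"
      using K decay_pos[of n] incr_le_incr_bound by (intro mult_left_mono) auto
    then have "slope n \<le> K * decay n * incr_bound n" using K(2)[of n] by linarith
    then have "(slope n)\<^sup>2 \<le> (K * decay n * incr_bound n)\<^sup>2" using slope_nonneg by (intro power_mono)
    then have "L * (slope n)\<^sup>2 \<le> L * (K * decay n * incr_bound n)\<^sup>2" using L by (intro mult_left_mono) auto
    then show ?thesis using L(2)[of n] by (simp add: K1_def power_mult_distrib mult_ac)
  qed
  obtain N0 where N0: "\<And>n. n \<ge> N0 \<Longrightarrow> K1 / sqrt (real (Suc n)) \<le> 1 / 4"
    by (rule eventually_inverse_sqrt_small[of "1/4" K1]) auto
  define N where "N = Suc N0"
  \<comment> \<open>The sum takes care of the indices up to \<open>N\<close>, the multiple of \<open>K1\<close> of the induction step.\<close>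
  define C where "C = 8 * K1 + (\<Sum>k\<le>N. V k)"
  have CV: "V k \<le> C" if "k \<le> N" for k
  proof -
    have "V k \<le> (\<Sum>k\<le>N. V k)" using that V_nonneg by (intro member_le_sum) auto
    then show ?thesis using K1 by (simp add: C_def)
  qed
  have C: "C \<ge> 8 * K1" "C > 0"
    using K1 V_nonneg by (auto simp: C_def intro!: sum_nonneg add_pos_nonneg)
  have "V n \<le> C * sqrt (real n) * (incr_bound n)\<^sup>2" for n
  proof (induction n rule: less_induct)
    case (less n)
    consider "n = 0" | "1 \<le> n" "n \<le> N" | "n > N" by linarith
    then show ?case
    proof cases
      case 1
      then show ?thesis by (simp add: V_0)
    next
      case 2
      have "V n \<le> C * 1 * 1" using CV 2 by simp
      also have "\<dots> \<le> C * sqrt (real n) * (incr_bound n)\<^sup>2"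
        using 2 C incr_bound_ge_1[of n] by (intro mult_mono mult_left_mono) auto
      finally show ?thesis .
    next
      case 3
      then obtain j where j: "n = Suc j" "j \<ge> 1" "j \<ge> N0" by (cases n) (auto simp: N_def)
      let ?s = "sqrt (real (Suc j))"
      have s: "?s > 0" by simp
      have rescale: "C * s * (K1 * d * e) = C * e * (K1 * ((s * s) * d) / s)" if "s > 0" for s d e :: real
        using that by simp
      have "avg j V \<le> avg j (\<lambda>k. C * sqrt (real j) * (incr_bound k)\<^sup>2)"
      proof (intro avg_mono)
        fix k assume k: "k \<le> j"
        then have "V k \<le> C * sqrt (real k) * (incr_bound k)\<^sup>2" using less j by simp
        also have "\<dots> \<le> C * sqrt (real j) * (incr_bound k)\<^sup>2"
          using k C by (intro mult_right_mono mult_left_mono) auto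
        finally show "V k \<le> C * sqrt (real j) * (incr_bound k)\<^sup>2" .
      qed
      also have "\<dots> = C * sqrt (real j) * avg j (\<lambda>k. (incr_bound k)\<^sup>2)" by (rule avg_cmult)
      also have "\<dots> \<le> C * ?s * (K1 * (decay j)\<^sup>2 * (incr_bound j)\<^sup>2)"
        using C E2[of j] by (intro mult_mono avg_nonneg) auto
      also have "\<dots> = C * (incr_bound j)\<^sup>2 * (K1 * ((?s * ?s) * (decay j)\<^sup>2) / ?s)" using s by (rule rescale)
      also have "?s * ?s = real (Suc j)" by simp
      also have "C * (incr_bound j)\<^sup>2 * (K1 * (real (Suc j) * (decay j)\<^sup>2) / ?s) = C * (incr_bound j)\<^sup>2 * ((K1 / ?s) / ?s)"
        unfolding Suc_times_decay_square by simp
      also have "\<dots> \<le> C * (incr_bound j)\<^sup>2 * ((1 / 4) / ?s)"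
        using N0[of j] j C by (intro mult_left_mono divide_right_mono) auto
      finally have u: "avg j V \<le> C * (incr_bound j)\<^sup>2 * (1 / (4 * ?s))" by simp
      obtain i where i: "j = Suc i" using j by (cases j) auto
      have "avg j (\<lambda>k. (m k)\<^sup>2) - (avg j m)\<^sup>2 \<le> real j * (q * (1 - q)) * avg i (\<lambda>k. (incr k)\<^sup>2)"
        using avg_poincare[of j m] i by (simp add: incr_def mult_ac)
      also have "\<dots> \<le> real j * 1 * (K1 * (decay i)\<^sup>2 * (incr_bound i)\<^sup>2)"
      proof (intro mult_mono)
        show "q * (1 - q) \<le> 1" using mult_mono[of q 1 "1 - q" 1] q_pos q_less_1 by simp
        have "avg i (\<lambda>k. (incr k)\<^sup>2) \<le> avg i (\<lambda>k. (incr_bound k)\<^sup>2)"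
          using incr_le_incr_bound incr_nonneg by (intro avg_mono power_mono) auto
        then show "avg i (\<lambda>k. (incr k)\<^sup>2) \<le> K1 * (decay i)\<^sup>2 * (incr_bound i)\<^sup>2" using E2[of i] by linarith
      qed (use q_pos q_less_1 in \<open>auto intro!: avg_nonneg\<close>)
      also have "\<dots> = K1 * (real (Suc i) * (decay i)\<^sup>2) * (incr_bound i)\<^sup>2" using i by simp
      also have "\<dots> = K1 * (1 / sqrt (real j)) * (incr_bound i)\<^sup>2"
        using Suc_times_decay_square[of i] i by simp
      also have "\<dots> \<le> (C / 8) * (2 / ?s) * (incr_bound j)\<^sup>2"
        using C K1 inverse_sqrt_le_Suc[of j] j i mono_incr_bound_square
        by (intro mult_mono) (auto simp: mono_iff_le_Suc)
      finally have v: "avg j (\<lambda>k. (m k)\<^sup>2) - (avg j m)\<^sup>2 \<le> C * (incr_bound j)\<^sup>2 * (1 / (4 * ?s))"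
        by (simp add: mult_ac)
      have "V n \<le> C * sqrt (real j) * (incr_bound j)\<^sup>2 + C * (incr_bound j)\<^sup>2 * (1 / (4 * ?s)) + C * (incr_bound j)\<^sup>2 * (1 / (4 * ?s))"
        using V_Suc[of j] j less[of j] u v by simp
      also have "\<dots> = C * (incr_bound j)\<^sup>2 * (sqrt (real j) + 1 / (2 * ?s))"
        using s by (simp add: field_simps)
      also have "\<dots> \<le> C * (incr_bound n)\<^sup>2 * ?s"
        using C sqrt_Suc_diff_ge[of j] j mono_incr_bound_square
        by (intro mult_mono) (auto simp: mono_iff_le_Suc)
      finally show ?thesis using j by (simp add: mult_ac)
    qed
  qed
  then show ?thesis using that C by blast
qed

text \<open>
  By the reversed Jensen inequality the bound of \<open>V_le\<close> averages to \<open>O(\<surd>n (slope n)\<^sup>2)\<close>, whereas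
  \<open>lin_var n\<close> is of order \<open>n (slope n)\<^sup>2\<close>.
\<close>
lemma avg_V_le:
  obtains K where "K > 0" "\<And>n. avg (Suc n) V \<le> K / sqrt (real (Suc n)) * lin_var n"
proof -
  obtain C where C: "C > 0" "\<And>n. V n \<le> C * sqrt (real n) * (incr_bound n)\<^sup>2" by (rule V_le) blast
  obtain L where L: "L > 0" "\<And>n. avg n (\<lambda>k. (incr_bound k)\<^sup>2) \<le> L * (slope n)\<^sup>2"
    by (rule avg_incr_bound_square_le_slope) blast
  define \<kappa> where "\<kappa> = 2 * (1 + 1 / q)"
  have \<kappa>: "\<kappa> > 0" using q_pos by (simp add: \<kappa>_def add_pos_pos)
  define w where "w = q * (1 - q)"
  have v: "w > 0" using q_pos q_less_1 by (simp add: w_def)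
  show ?thesis
  proof
    show "C * L * \<kappa>\<^sup>2 / w > 0" using C L \<kappa> v by simp
    fix n
    let ?s = "sqrt (real (Suc n))"
    have "avg (Suc n) V \<le> avg (Suc n) (\<lambda>k. C * ?s * (incr_bound k)\<^sup>2)"
    proof (intro avg_mono)
      fix k assume k: "k \<le> Suc n"
      have "V k \<le> C * sqrt (real k) * (incr_bound k)\<^sup>2" by (rule C)
      also have "\<dots> \<le> C * ?s * (incr_bound k)\<^sup>2" using k C by (intro mult_right_mono mult_left_mono) auto
      finally show "V k \<le> C * ?s * (incr_bound k)\<^sup>2" .
    qed
    also have "\<dots> = C * ?s * avg (Suc n) (\<lambda>k. (incr_bound k)\<^sup>2)" by (rule avg_cmult)
    also have "\<dots> \<le> C * ?s * (L * (\<kappa> * slope n)\<^sup>2)"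
    proof (intro mult_left_mono)
      have "(slope (Suc n))\<^sup>2 \<le> (\<kappa> * slope n)\<^sup>2"
        using slope_Suc_le[of n] slope_nonneg by (intro power_mono) (auto simp: \<kappa>_def)
      then show "avg (Suc n) (\<lambda>k. (incr_bound k)\<^sup>2) \<le> L * (\<kappa> * slope n)\<^sup>2"
        using L by (meson less_imp_le mult_left_mono order_trans)
    qed (use C in auto)
    also have "\<dots> = C * L * \<kappa>\<^sup>2 / w / ?s * (real (Suc n) * w * (slope n)\<^sup>2)"
    proof -
      define s where "s = ?s"
      have "s > 0" "real (Suc n) = s * s" by (simp_all add: s_def)
      then show ?thesis using v unfolding s_def [symmetric]
        by (simp add: power_mult_distrib mult_ac del: of_nat_Suc)
    qed
    also have "\<dots> = C * L * \<kappa>\<^sup>2 / w / ?s * lin_var n" by (simp add: lin_var_def w_def)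
    finally show "avg (Suc n) V \<le> C * L * \<kappa>\<^sup>2 / w / ?s * lin_var n" .
  qed
qed

end

section \<open>Weighted means and characteristic functions of binomial variables\<close>

text \<open>
  A weighted form of Cesaro's theorem.
\<close>
lemma weighted_mean_tendsto_0:
  fixes l e :: "nat \<Rightarrow> real"
  assumes l: "\<And>n. 0 \<le> l n" and div: "filterlim (\<lambda>N. \<Sum>n<N. l n) at_top sequentially"
    and e: "e \<longlonglongrightarrow> 0"
  shows "(\<lambda>N. (\<Sum>n<N. e n * l n) / (\<Sum>n<N. l n)) \<longlonglongrightarrow> 0"
proof (rule LIMSEQ_I)
  fix \<epsilon> :: real assume \<epsilon>: "0 < \<epsilon>"
  obtain M where M: "\<And>n. n \<ge> M \<Longrightarrow> \<bar>e n\<bar> < \<epsilon> / 2"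
    using LIMSEQ_D[OF e, of "\<epsilon> / 2"] \<epsilon> by auto
  define A where "A = (\<Sum>n<M. \<bar>e n\<bar> * l n)"
  have "eventually (\<lambda>N. (\<Sum>n<N. l n) > 2 * A / \<epsilon> \<and> (\<Sum>n<N. l n) > 0) sequentially"
    using div by (intro eventually_conj filterlim_at_top_dense[THEN iffD1, rule_format]) auto
  then obtain N0 where N0: "\<And>N. N \<ge> N0 \<Longrightarrow> (\<Sum>n<N. l n) > 2 * A / \<epsilon> \<and> (\<Sum>n<N. l n) > 0"
    by (auto simp: eventually_sequentially)
  have "norm ((\<Sum>n<N. e n * l n) / (\<Sum>n<N. l n) - 0) < \<epsilon>" if "N \<ge> max M N0" for N
  proof -
    let ?L = "\<Sum>n<N. l n"
    have "{..<N} = {..<M} \<union> {M..<N}" using that by auto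
    then have "(\<Sum>n<N. \<bar>e n\<bar> * l n) = A + (\<Sum>n\<in>{M..<N}. \<bar>e n\<bar> * l n)"
      unfolding A_def by (metis finite_atLeastLessThan finite_lessThan ivl_disj_int_one(2) sum.union_disjoint)
    also have "(\<Sum>n\<in>{M..<N}. \<bar>e n\<bar> * l n) \<le> (\<Sum>n\<in>{M..<N}. \<epsilon> / 2 * l n)"
      using M l by (intro sum_mono mult_right_mono) (auto intro: less_imp_le)
    also have "\<dots> \<le> (\<Sum>n<N. \<epsilon> / 2 * l n)"
      using l \<epsilon> by (intro sum_mono2) auto
    also have "\<dots> = \<epsilon> / 2 * ?L" by (simp add: sum_distrib_left)
    finally have "(\<Sum>n<N. \<bar>e n\<bar> * l n) \<le> A + \<epsilon> / 2 * ?L" by simp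
    moreover have "\<bar>\<Sum>n<N. e n * l n\<bar> \<le> (\<Sum>n<N. \<bar>e n\<bar> * l n)"
      using l by (intro order_trans[OF sum_abs] sum_mono) (simp add: abs_mult)
    moreover have "A < \<epsilon> / 2 * ?L" "?L > 0" using N0[of N] that \<epsilon> by (auto simp: field_simps)
    ultimately have "\<bar>\<Sum>n<N. e n * l n\<bar> < \<epsilon> * ?L" by simp
    then show ?thesis using \<open>?L > 0\<close> by (simp add: pos_divide_less_eq)
  qed
  then show "\<exists>no. \<forall>n\<ge>no. norm ((\<Sum>n<n. e n * l n) / (\<Sum>n<n. l n) - 0) < \<epsilon>" by blast
qed

lemma norm_iexp_diff_1_le: "norm (iexp x - 1) \<le> \<bar>x\<bar>"
  using iexp_approx1[of x 0] by simp

lemma norm_iexp_diff_linear_le: "norm (iexp x - 1 - \<i> * x) \<le> x\<^sup>2 / 2"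
  using iexp_approx1[of x 1] by (simp add: numeral_2_eq_2 diff_diff_eq)

lemma exp_minus_quadratic_bound:
  fixes x :: real
  assumes "0 \<le> x"
  shows "\<bar>(1 - x) - exp (- x)\<bar> \<le> x\<^sup>2 / 2"
proof -
  have low: "1 - x \<le> exp (- x)" using exp_ge_add_one_self[of "- x"] by simp
  have "1 \<le> (1 - x + x\<^sup>2 / 2) * (1 + x + x\<^sup>2 / 2)"
  proof -
    have "(1 - x + x\<^sup>2 / 2) * (1 + x + x\<^sup>2 / 2) = 1 + (x\<^sup>2)\<^sup>2 / 4"
      by (simp add: power2_eq_square algebra_simps)
    then show ?thesis by simp
  qed
  also have "\<dots> \<le> (1 - x + x\<^sup>2 / 2) * exp x"
  proof (intro mult_left_mono exp_lower_Taylor_quadratic assms)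
    have "0 \<le> (1 - x)\<^sup>2" by simp
    then show "0 \<le> 1 - x + x\<^sup>2 / 2" by (simp add: power2_eq_square algebra_simps)
  qed
  finally have "exp (- x) \<le> 1 - x + x\<^sup>2 / 2" by (simp add: exp_minus divide_simps mult_ac)
  with low show ?thesis by simp
qed

context binomial_average
begin

lemma avg_index: "avg n real = real n * q"
  using avg_centred[of n] by (simp add: avg_diff)

text \<open>
  The characteristic function of a centred Bernoulli variable with success probability \<open>q\<close>.
\<close>
definition bernoulli_char :: "real \<Rightarrow> complex" where
  "bernoulli_char \<theta> = of_real (1 - q) * iexp (- (q * \<theta>)) + of_real q * iexp ((1 - q) * \<theta>)"

lemma norm_bernoulli_char_le: "norm (bernoulli_char \<theta>) \<le> 1"
proof -
  have "norm (bernoulli_char \<theta>) \<le> (1 - q) + q"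
    unfolding bernoulli_char_def using q_pos q_less_1
    by (intro order_trans[OF norm_triangle_ineq]) (simp add: norm_mult del: of_real_diff)
  then show ?thesis by simp
qed

lemma avg_iexp: "avg n (\<lambda>k. iexp (\<theta> * (real k - real n * q))) = bernoulli_char \<theta> ^ n"
proof (induction n)
  case (Suc n)
  let ?f = "\<lambda>k. iexp (\<theta> * (real k - real n * q))"
  have 1: "iexp (\<theta> * (real k - real (Suc n) * q)) = iexp (- (q * \<theta>)) * ?f k" for k
    by (simp add: exp_add [symmetric] algebra_simps)
  have 2: "iexp (\<theta> * (real (Suc k) - real (Suc n) * q)) = iexp ((1 - q) * \<theta>) * ?f k" for k
    by (simp add: exp_add [symmetric] algebra_simps)
  show ?case unfolding avg_Suc 2 unfolding 1 avg_cmult Suc.IH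
    by (simp add: bernoulli_char_def scaleR_conv_of_real algebra_simps)
qed simp

text \<open>
  Both sides have the same Taylor polynomial of second order, \<open>1 - q (1 - q) \<theta>\<^sup>2 / 2\<close>. Beyond
  \<open>\<bar>\<theta>\<bar> = 1\<close> the bound is trivial.
\<close>
lemma bernoulli_char_approx:
  "norm (bernoulli_char \<theta> - of_real (exp (- (q * (1 - q) * \<theta>\<^sup>2 / 2)))) \<le> 2 * \<bar>\<theta>\<bar> ^ 3"
proof (cases "\<bar>\<theta>\<bar> \<le> 1")
  case True
  define x where "x = q * (1 - q) * \<theta>\<^sup>2 / 2"
  let ?T = "\<lambda>y. (\<Sum>k\<le>2. (\<i> * complex_of_real y) ^ k / fact k)"
  have T: "norm (iexp y - ?T y) \<le> \<bar>\<theta>\<bar> ^ 3 / 6" if "\<bar>y\<bar> \<le> \<bar>\<theta>\<bar>" for y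
  proof -
    have "norm (iexp y - ?T y) \<le> \<bar>y\<bar> ^ 3 / 6"
      using iexp_approx1[of y 2] by (simp add: numeral_3_eq_3 numeral_2_eq_2 fact_numeral)
    also have "\<dots> \<le> \<bar>\<theta>\<bar> ^ 3 / 6" using that by (intro divide_right_mono power_mono) auto
    finally show ?thesis .
  qed
  have regroup: "a * X + b * Y - c = a * (X - X') + b * (Y - Y')" if "a * X' + b * Y' = c"
    for a b c X X' Y Y' :: complex
    using that by (auto simp: algebra_simps)
  have "of_real (1 - q) * ?T (- (q * \<theta>)) + of_real q * ?T ((1 - q) * \<theta>) = of_real (1 - x)"
    unfolding x_def
    by (simp add: numeral_2_eq_2 complex_eq_iff power2_eq_square algebra_simps)
      (simp add: field_simps)
  then have "bernoulli_char \<theta> - of_real (1 - x)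
      = of_real (1 - q) * (iexp (- (q * \<theta>)) - ?T (- (q * \<theta>)))
      + of_real q * (iexp ((1 - q) * \<theta>) - ?T ((1 - q) * \<theta>))"
    unfolding bernoulli_char_def by (rule regroup)
  also have "norm \<dots> \<le> norm (of_real (1 - q) * (iexp (- (q * \<theta>)) - ?T (- (q * \<theta>))))
      + norm (of_real q * (iexp ((1 - q) * \<theta>) - ?T ((1 - q) * \<theta>)))"
    by (rule norm_triangle_ineq)
  also have "\<dots> \<le> (1 - q) * (\<bar>\<theta>\<bar> ^ 3 / 6) + q * (\<bar>\<theta>\<bar> ^ 3 / 6)"
    unfolding norm_mult norm_of_real using q_pos q_less_1
    by (intro add_mono mult_mono T) (auto simp: abs_mult mult_left_le_one_le)
  also have "\<dots> = ((1 - q) + q) * (\<bar>\<theta>\<bar> ^ 3 / 6)" by (rule distrib_right [symmetric])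
  also have "\<dots> = \<bar>\<theta>\<bar> ^ 3 / 6" by simp
  finally have 1: "norm (bernoulli_char \<theta> - of_real (1 - x)) \<le> \<bar>\<theta>\<bar> ^ 3 / 6" .
  have x0: "0 \<le> x" using q_pos q_less_1 by (simp add: x_def)
  have "q * (1 - q) \<le> 1" using mult_mono[of q 1 "1 - q" 1] q_pos q_less_1 by simp
  then have "q * (1 - q) * \<theta>\<^sup>2 \<le> 1 * \<theta>\<^sup>2" by (intro mult_right_mono) auto
  then have x1: "x \<le> \<bar>\<theta>\<bar>\<^sup>2"
    unfolding x_def power2_abs using zero_le_power2[of \<theta>] by linarith
  have "norm (complex_of_real (1 - x) - of_real (exp (- x))) = \<bar>(1 - x) - exp (- x)\<bar>"
    by (metis norm_of_real of_real_diff)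
  also have "\<dots> \<le> x\<^sup>2 / 2" by (rule exp_minus_quadratic_bound[OF x0])
  also have "\<dots> \<le> (\<bar>\<theta>\<bar>\<^sup>2)\<^sup>2 / 2" using x0 x1 by (intro divide_right_mono power_mono) auto
  also have "(\<bar>\<theta>\<bar>\<^sup>2)\<^sup>2 = \<bar>\<theta>\<bar> * \<bar>\<theta>\<bar> ^ 3" by (simp add: power2_eq_square power3_eq_cube)
  also have "\<dots> \<le> 1 * \<bar>\<theta>\<bar> ^ 3" using True by (intro mult_right_mono) auto
  finally have 2: "norm (complex_of_real (1 - x) - of_real (exp (- x))) \<le> \<bar>\<theta>\<bar> ^ 3 / 2" by simp
  have "norm (bernoulli_char \<theta> - of_real (exp (- x))) \<le> \<bar>\<theta>\<bar> ^ 3 / 6 + \<bar>\<theta>\<bar> ^ 3 / 2"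
    using norm_triangle_mono[OF 1 2] by simp
  also have "\<dots> \<le> 2 * \<bar>\<theta>\<bar> ^ 3" by simp
  finally show ?thesis by (simp add: x_def)
next
  case False
  let ?e = "exp (- (q * (1 - q) * \<theta>\<^sup>2 / 2))"
  have "?e \<le> 1" using q_pos q_less_1 by simp
  then have "norm (bernoulli_char \<theta> - of_real ?e) \<le> 1 + 1"
    by (intro order_trans[OF norm_triangle_ineq4] add_mono norm_bernoulli_char_le) simp
  also have "\<dots> \<le> 2 * \<bar>\<theta>\<bar> ^ 3" using False by simp
  finally show ?thesis .
qed

end

section \<open>The central limit theorem for the recurrence\<close>

text \<open>
  Here \<open>\<psi> n\<close> plays the role of the characteristic function of the centred \<open>n\<close>-th random variable; its
  recurrence expresses the independence of the summands.
\<close>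
locale char_recurrence = moment_recurrence +
  fixes \<psi> :: "nat \<Rightarrow> real \<Rightarrow> complex"
  assumes \<psi>_0: "\<psi> 0 t = 1"
    and \<psi>_Suc: "\<psi> (Suc n) t = \<psi> n t * avg n (\<lambda>k. iexp (t * (m k - avg n m)) * \<psi> k t)"
    and norm_\<psi>_le: "norm (\<psi> n t) \<le> 1"
    and \<psi>_second_order: "norm (\<psi> n t - 1) \<le> t\<^sup>2 / 2 * V n"
begin

definition step_char :: "nat \<Rightarrow> real \<Rightarrow> complex" where
  "step_char n t = avg (Suc n) (\<lambda>k. iexp (t * (m k - avg (Suc n) m)) * \<psi> k t)"

lemma \<psi>_eq_prod: "\<psi> (Suc N) t = (\<Prod>n<N. step_char n t)"
proof (induction N)
  case 0
  then show ?case using m_0 by (simp add: \<psi>_Suc \<psi>_0)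
next
  case (Suc N)
  show ?case by (subst \<psi>_Suc) (simp add: Suc.IH step_char_def)
qed

lemma norm_step_char_le: "norm (step_char n t) \<le> 1"
proof -
  have "norm (step_char n t) \<le> avg (Suc n) (\<lambda>k. norm (iexp (t * (m k - avg (Suc n) m)) * \<psi> k t))"
    unfolding step_char_def by (rule norm_avg_le)
  also have "\<dots> \<le> avg (Suc n) (\<lambda>k. 1)"
    using norm_\<psi>_le by (intro avg_mono) (simp add: norm_mult)
  finally show ?thesis by simp
qed

definition rest :: "nat \<Rightarrow> nat \<Rightarrow> real" where
  "rest n k = m k - avg (Suc n) m - slope n * (real k - real (Suc n) * q)"

lemma avg_rest: "avg (Suc n) (rest n) = 0"
proof -
  have "avg (Suc n) (\<lambda>k. m k - avg (Suc n) m - slope n * (real k - real (Suc n) * q)) = 0"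
    by (simp add: avg_diff avg_cmult avg_index)
  then show ?thesis by (simp add: rest_def[abs_def])
qed

lemma avg_linear_square:
  "avg (Suc n) (\<lambda>k. (slope n * (real k - real (Suc n) * q))\<^sup>2) = lin_var n"
  unfolding power_mult_distrib avg_cmult avg_centred_square by (simp add: lin_var_def mult_ac)

lemma avg_rest_square:
  "avg (Suc n) (\<lambda>k. (rest n k)\<^sup>2)
    = avg (Suc n) (\<lambda>k. (m k)\<^sup>2) - (avg (Suc n) m)\<^sup>2 - lin_var n"
proof -
  define \<mu> where "\<mu> = avg (Suc n) m"
  let ?z = "\<lambda>k. real k - real (Suc n) * q"
  have cov: "avg (Suc n) (\<lambda>k. ?z k * m k) = real (Suc n) * (q * (1 - q)) * slope n"
    using avg_stein[of n m] by (simp add: slope_def incr_def[abs_def] mult_ac)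
  have "avg (Suc n) (\<lambda>k. (rest n k)\<^sup>2) = avg (Suc n) (\<lambda>k. ((m k - \<mu>)\<^sup>2 + (slope n * ?z k)\<^sup>2)
      - (2 * slope n * (?z k * m k) - 2 * slope n * \<mu> * ?z k))"
    by (intro avg_cong) (simp add: rest_def \<mu>_def power2_eq_square algebra_simps)
  also have "\<dots> = avg (Suc n) (\<lambda>k. (m k - \<mu>)\<^sup>2) + lin_var n
      - (2 * slope n * (real (Suc n) * (q * (1 - q)) * slope n) - 2 * slope n * \<mu> * 0)"
    unfolding avg_diff[of _ "\<lambda>k. (m k - \<mu>)\<^sup>2 + (slope n * ?z k)\<^sup>2"]
      avg_diff[of _ "\<lambda>k. 2 * slope n * (?z k * m k)"] avg_add avg_cmult avg_linear_square cov avg_centred ..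
  also have "\<dots> = avg (Suc n) (\<lambda>k. (m k - \<mu>)\<^sup>2) - lin_var n"
    by (simp add: lin_var_def power2_eq_square mult_ac)
  also have "avg (Suc n) (\<lambda>k. (m k - \<mu>)\<^sup>2) = avg (Suc n) (\<lambda>k. (m k)\<^sup>2) - \<mu>\<^sup>2"
    unfolding \<mu>_def by (rule avg_variance)
  finally show ?thesis by (simp add: \<mu>_def)
qed

text \<open>
  A summand may be replaced by its linear part. The fluctuation of \<open>\<psi> k\<close> around \<open>1\<close> has no
  first-order term, so that it costs only a variance. The part \<open>rest\<close> that the regression of \<open>m\<close> leaves
  unexplained is centred, but it depends on
  the linear part; the mixed term \<open>(exp (i t L) - 1) (i t rest)\<close> is of second order and is bounded by the
  inequality between the arithmetic and the geometric mean, weighted by \<open>\<delta>\<close>.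
\<close>
lemma step_char_linear_approx:
  assumes \<delta>: "\<delta> > 0" and rest: "avg (Suc n) (\<lambda>k. (rest n k)\<^sup>2) \<le> \<delta>\<^sup>2 * lin_var n"
    and V: "avg (Suc n) V \<le> \<delta>\<^sup>2 * lin_var n"
  shows "norm (step_char n t - bernoulli_char (t * slope n) ^ Suc n) \<le> t\<^sup>2 * ((\<delta>\<^sup>2 + \<delta>) * lin_var n)"
proof -
  let ?N = "Suc n"
  define L where "L k = slope n * (real k - real ?N * q)" for k
  define W where "W k = m k - avg ?N m" for k
  have W: "W k = L k + rest n k" for k by (simp add: W_def L_def rest_def)
  have \<eta>: "bernoulli_char (t * slope n) ^ ?N = avg ?N (\<lambda>k. iexp (t * L k))"
    unfolding L_def avg_iexp [symmetric] by (simp only: mult.assoc)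
  have split: "iexp (t * W k) * \<psi> k t - iexp (t * L k)
      = (iexp (t * W k) * (\<psi> k t - 1) + (iexp (t * L k) * (iexp (t * rest n k) - 1 - \<i> * (t * rest n k))
         + (iexp (t * L k) - 1) * (\<i> * (t * rest n k)))) + \<i> * t * rest n k" for k
  proof -
    have "iexp (t * W k) = iexp (t * L k) * iexp (t * rest n k)"
      by (simp add: W exp_add [symmetric] algebra_simps)
    then show ?thesis by (simp add: algebra_simps)
  qed
  define F where "F k = iexp (t * W k) * (\<psi> k t - 1) + (iexp (t * L k) * (iexp (t * rest n k) - 1 - \<i> * (t * rest n k))
         + (iexp (t * L k) - 1) * (\<i> * (t * rest n k)))" for k
  have "step_char n t - bernoulli_char (t * slope n) ^ ?N
      = avg ?N (\<lambda>k. iexp (t * W k) * \<psi> k t - iexp (t * L k))"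
    unfolding \<eta> step_char_def avg_diff W_def ..
  also have "\<dots> = avg ?N F + \<i> * t * of_real (avg ?N (rest n))"
    unfolding split F_def [symmetric] avg_add avg_cmult avg_of_real ..
  also have "\<dots> = avg ?N F" by (simp add: avg_rest)
  finally have "norm (step_char n t - bernoulli_char (t * slope n) ^ ?N) \<le> avg ?N (\<lambda>k. norm (F k))"
    using norm_avg_le[of ?N F] by simp
  also have "\<dots> \<le> avg ?N (\<lambda>k. t\<^sup>2 / 2 * V k + (t\<^sup>2 / 2 * (1 + 1 / \<delta>) * (rest n k)\<^sup>2 + t\<^sup>2 / 2 * \<delta> * (L k)\<^sup>2))"
  proof (intro avg_mono)
    fix k
    let ?R = "rest n k"
    have 1: "norm (iexp (t * W k) * (\<psi> k t - 1)) \<le> t\<^sup>2 / 2 * V k"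
      using \<psi>_second_order by (simp add: norm_mult)
    have 2: "norm (iexp (t * L k) * (iexp (t * ?R) - 1 - \<i> * (t * ?R))) \<le> t\<^sup>2 / 2 * ?R\<^sup>2"
      using norm_iexp_diff_linear_le[of "t * ?R"] by (simp add: norm_mult power_mult_distrib)
    have "norm ((iexp (t * L k) - 1) * (\<i> * (t * ?R))) \<le> \<bar>t * L k\<bar> * \<bar>t * ?R\<bar>"
      unfolding norm_mult[of "iexp (t * L k) - 1"]
      by (intro mult_mono norm_iexp_diff_1_le) (auto simp: norm_mult)
    also have "\<dots> = t\<^sup>2 * (\<bar>L k\<bar> * \<bar>?R\<bar>)" by (simp add: abs_mult power2_eq_square)
    also have "\<bar>L k\<bar> * \<bar>?R\<bar> \<le> \<delta> / 2 * (L k)\<^sup>2 + 1 / (2 * \<delta>) * ?R\<^sup>2"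
    proof -
      have "0 \<le> (\<delta> * \<bar>L k\<bar> - \<bar>?R\<bar>)\<^sup>2 / (2 * \<delta>)" using \<delta> by simp
      also have "\<dots> = \<delta> / 2 * (L k)\<^sup>2 + 1 / (2 * \<delta>) * ?R\<^sup>2 - \<bar>L k\<bar> * \<bar>?R\<bar>"
        using \<delta> by (simp add: power2_diff power_mult_distrib power2_eq_square field_simps)
      finally show ?thesis by simp
    qed
    finally have 3: "norm ((iexp (t * L k) - 1) * (\<i> * (t * ?R)))
        \<le> t\<^sup>2 * (\<delta> / 2 * (L k)\<^sup>2 + 1 / (2 * \<delta>) * ?R\<^sup>2)" by (simp add: mult_left_mono)
    have "norm (F k) \<le> t\<^sup>2 / 2 * V k + (t\<^sup>2 / 2 * ?R\<^sup>2 + t\<^sup>2 * (\<delta> / 2 * (L k)\<^sup>2 + 1 / (2 * \<delta>) * ?R\<^sup>2))"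
      unfolding F_def by (intro norm_triangle_mono 1 2 3)
    also have "\<dots> = t\<^sup>2 / 2 * V k + (t\<^sup>2 / 2 * (1 + 1 / \<delta>) * ?R\<^sup>2 + t\<^sup>2 / 2 * \<delta> * (L k)\<^sup>2)"
      by (simp add: field_simps)
    finally show "norm (F k) \<le> t\<^sup>2 / 2 * V k + (t\<^sup>2 / 2 * (1 + 1 / \<delta>) * ?R\<^sup>2 + t\<^sup>2 / 2 * \<delta> * (L k)\<^sup>2)" .
  qed
  also have "\<dots> = t\<^sup>2 / 2 * avg ?N V + (t\<^sup>2 / 2 * (1 + 1 / \<delta>) * avg ?N (\<lambda>k. (rest n k)\<^sup>2) + t\<^sup>2 / 2 * \<delta> * lin_var n)"
    unfolding L_def avg_add avg_cmult avg_linear_square ..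
  also have "\<dots> \<le> t\<^sup>2 / 2 * (\<delta>\<^sup>2 * lin_var n)
      + (t\<^sup>2 / 2 * (1 + 1 / \<delta>) * (\<delta>\<^sup>2 * lin_var n) + t\<^sup>2 / 2 * \<delta> * lin_var n)"
    using \<delta> by (intro add_mono mult_left_mono rest V) auto
  also have "\<dots> = t\<^sup>2 * ((\<delta>\<^sup>2 + \<delta>) * lin_var n)"
    using \<delta> by (simp add: field_simps power2_eq_square)
  finally show ?thesis .
qed

definition total_lin_var :: "nat \<Rightarrow> real" where "total_lin_var N = (\<Sum>n<N. lin_var n)"

lemma total_lin_var_pos: "0 < N \<Longrightarrow> 0 < total_lin_var N"
  unfolding total_lin_var_def using lin_var_pos by (intro sum_pos) auto

lemma total_lin_var_at_top: "filterlim total_lin_var at_top sequentially"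
proof (rule filterlim_at_top_mono)
  define c where "c = q * (1 - q) * q\<^sup>2"
  have c: "c > 0" using q_pos q_less_1 by (simp add: c_def)
  show "filterlim (\<lambda>N. c * real N) at_top sequentially"
    using c by (intro filterlim_tendsto_pos_mult_at_top[OF tendsto_const] filterlim_real_sequentially)
  have "c \<le> lin_var n" for n
    using lin_var_ge[of n] c mult_right_mono[of 1 "real (Suc n)" c] by (simp add: c_def)
  then have "real N * c \<le> total_lin_var N" for N
    using sum_mono[of "{..<N}" "\<lambda>_. c" lin_var] by (simp add: total_lin_var_def)
  then show "eventually (\<lambda>N. c * real N \<le> total_lin_var N) sequentially"
    by (simp add: mult.commute)
qed

lemma V_eq_sum:
  "V (Suc N) = total_lin_var N + (\<Sum>n<N. avg (Suc n) V + avg (Suc n) (\<lambda>k. (rest n k)\<^sup>2))"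
proof (induction N)
  case 0
  then show ?case using V_Suc[of 0] by (simp add: V_0 total_lin_var_def)
next
  case (Suc N)
  then show ?case using V_Suc[of "Suc N"] avg_rest_square[of N] by (simp add: total_lin_var_def)
qed

lemma total_lin_var_le_V: "total_lin_var N \<le> V (Suc N)"
proof -
  have "0 \<le> (\<Sum>n<N. avg (Suc n) V + avg (Suc n) (\<lambda>k. (rest n k)\<^sup>2))"
    by (intro sum_nonneg add_nonneg_nonneg avg_nonneg V_nonneg) auto
  then show ?thesis unfolding V_eq_sum by simp
qed

text \<open>
  The linear parts together are a sum of independent centred Bernoulli variables, \<open>n + 1\<close> of them
  scaled by \<open>slope n\<close>, so the error is governed by the sum of the cubes of the scales.
\<close>
lemma char_product_approx:
  "norm ((\<Prod>n<N. bernoulli_char (t * slope n) ^ Suc n) - of_real (exp (- (t\<^sup>2 * total_lin_var N / 2))))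
    \<le> 2 * \<bar>t\<bar> ^ 3 * (\<Sum>n<N. real (Suc n) * slope n ^ 3)"
proof -
  let ?b = "\<lambda>n. bernoulli_char (t * slope n)"
  let ?e = "\<lambda>n. complex_of_real (exp (- (q * (1 - q) * (t * slope n)\<^sup>2 / 2)))"
  have e: "norm (?e n) \<le> 1" for n
    using q_pos q_less_1 by (simp add: norm_exp_eq_Re)
  have "complex_of_real (exp (- (t\<^sup>2 * total_lin_var N / 2))) = (\<Prod>n<N. ?e n ^ Suc n)"
  proof -
    have "- (t\<^sup>2 * total_lin_var N / 2) = (\<Sum>n<N. real (Suc n) * - (q * (1 - q) * (t * slope n)\<^sup>2 / 2))"
      unfolding total_lin_var_def sum_distrib_left sum_divide_distrib sum_negf [symmetric] lin_var_def
      by (intro sum.cong) (simp_all add: power_mult_distrib)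
    then have "exp (- (t\<^sup>2 * total_lin_var N / 2)) = (\<Prod>n<N. exp (- (q * (1 - q) * (t * slope n)\<^sup>2 / 2)) ^ Suc n)"
      by (simp only: exp_sum[OF finite_lessThan] exp_of_nat_mult)
    then show ?thesis by simp
  qed
  then have "norm ((\<Prod>n<N. ?b n ^ Suc n) - of_real (exp (- (t\<^sup>2 * total_lin_var N / 2))))
      = norm ((\<Prod>n<N. ?b n ^ Suc n) - (\<Prod>n<N. ?e n ^ Suc n))" by simp
  also have "\<dots> \<le> (\<Sum>n<N. norm (?b n ^ Suc n - ?e n ^ Suc n))"
    using norm_bernoulli_char_le e
    by (intro norm_prod_diff) (auto simp only: norm_power intro!: power_le_one norm_ge_zero)
  also have "\<dots> \<le> (\<Sum>n<N. real (Suc n) * norm (?b n - ?e n))"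
    by (intro sum_mono norm_power_diff norm_bernoulli_char_le e)
  also have "\<dots> \<le> (\<Sum>n<N. real (Suc n) * (2 * \<bar>t * slope n\<bar> ^ 3))"
    by (intro sum_mono mult_left_mono bernoulli_char_approx) auto
  also have "\<dots> = 2 * \<bar>t\<bar> ^ 3 * (\<Sum>n<N. real (Suc n) * slope n ^ 3)"
    unfolding sum_distrib_left using slope_nonneg
    by (intro sum.cong) (simp_all add: abs_mult power_mult_distrib)
  finally show ?thesis .
qed

text \<open>
  A single \<open>lin_var n\<close> is below the total, which bounds \<open>slope n\<close> by \<open>sqrt (total_lin_var N)\<close> times a
  multiple of \<open>1 / sqrt (n + 1)\<close>. One of the three factors \<open>slope n\<close> is replaced by this bound; the
  other two rebuild \<open>lin_var n\<close>.
\<close>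
lemma third_moments_le:
  "(\<Sum>n<N. real (Suc n) * slope n ^ 3)
    \<le> sqrt (total_lin_var N) / sqrt (q * (1 - q)) ^ 3 * (\<Sum>n<N. 1 / sqrt (real (Suc n)) * lin_var n)"
proof -
  define w where "w = sqrt (q * (1 - q))"
  have w: "w > 0" "q * (1 - q) = w * w" using q_pos q_less_1 by (simp_all add: w_def)
  have "real (Suc n) * slope n ^ 3 \<le> sqrt (total_lin_var N) / w ^ 3 * (1 / sqrt (real (Suc n)) * lin_var n)"
    if "n < N" for n
  proof -
    define s where "s = sqrt (real (Suc n))"
    have s: "s > 0" "real (Suc n) = s * s" by (simp_all add: s_def)
    have l: "lin_var n = (s * w * slope n)\<^sup>2"
      by (simp add: lin_var_def s w power2_eq_square del: of_nat_Suc)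
    have "lin_var n \<le> total_lin_var N"
      unfolding total_lin_var_def using that lin_var_pos by (intro member_le_sum) (auto intro: less_imp_le)
    then have "s * w * slope n \<le> sqrt (total_lin_var N)"
      unfolding l by (rule real_le_rsqrt)
    then have "(s * w * slope n) * (s * slope n ^ 2 / w) \<le> sqrt (total_lin_var N) * (s * slope n ^ 2 / w)"
      using s w by (intro mult_right_mono) auto
    also have "(s * w * slope n) * (s * slope n ^ 2 / w) = real (Suc n) * slope n ^ 3"
      using w(1) unfolding s(2) by (simp add: power2_eq_square power3_eq_cube)
    also have "sqrt (total_lin_var N) * (s * slope n ^ 2 / w) = sqrt (total_lin_var N) / w ^ 3 * (1 / s * lin_var n)"
      using w(1) s(1) unfolding l by (simp add: power2_eq_square power3_eq_cube)
    finally show ?thesis by (simp add: s_def)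
  qed
  then show ?thesis unfolding sum_distrib_left w_def [symmetric] by (intro sum_mono) auto
qed

text \<open>
  After normalisation both errors, of linearisation and of Gaussian approximation, become means of null
  sequences weighted by \<open>lin_var\<close>, and \<open>V\<close> is asymptotic to the total of \<open>lin_var\<close>.
\<close>
theorem \<psi>_tendsto_normal:
  "(\<lambda>N. \<psi> N (t / sqrt (V N))) \<longlonglongrightarrow> of_real (exp (- (t\<^sup>2 / 2)))"
proof -
  obtain K1 where K1: "K1 > 0"
    "\<And>n. avg (Suc n) (\<lambda>k. (m k)\<^sup>2) - (avg (Suc n) m)\<^sup>2 - lin_var n \<le> K1 / sqrt (real (Suc n)) * lin_var n"
    by (rule index_variance_le) blast
  obtain K2 where K2: "K2 > 0" "\<And>n. avg (Suc n) V \<le> K2 / sqrt (real (Suc n)) * lin_var n"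
    by (rule avg_V_le) blast
  define g where "g n = 1 / sqrt (real (Suc n))" for n
  define \<delta> where "\<delta> n = sqrt ((K1 + K2) * g n)" for n
  have g: "g \<longlonglongrightarrow> 0" "g n > 0" for n
    using inverse_sqrt_Suc_tendsto_0 by (simp_all add: g_def[abs_def])
  have \<delta>: "\<delta> n > 0" "(\<delta> n)\<^sup>2 = (K1 + K2) * g n" for n
    using g(2)[of n] K1(1) K2(1) by (simp_all add: \<delta>_def)
  have \<delta>_lim: "\<delta> \<longlonglongrightarrow> 0"
  proof -
    have "(\<lambda>n. sqrt ((K1 + K2) * g n)) \<longlonglongrightarrow> sqrt ((K1 + K2) * 0)"
      by (intro tendsto_real_sqrt tendsto_mult tendsto_const g)
    then show ?thesis by (simp add: \<delta>_def[abs_def])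
  qed
  have Vr: "avg (Suc n) V \<le> (\<delta> n)\<^sup>2 * lin_var n"
    and rest: "avg (Suc n) (\<lambda>k. (rest n k)\<^sup>2) \<le> (\<delta> n)\<^sup>2 * lin_var n" for n
  proof -
    have "K2 / sqrt (real (Suc n)) * lin_var n \<le> (\<delta> n)\<^sup>2 * lin_var n"
      "K1 / sqrt (real (Suc n)) * lin_var n \<le> (\<delta> n)\<^sup>2 * lin_var n"
      unfolding \<delta>(2) using K1(1) K2(1) lin_var_pos[of n]
      by (auto intro!: mult_right_mono divide_right_mono simp: g_def)
    then show "avg (Suc n) V \<le> (\<delta> n)\<^sup>2 * lin_var n"
      "avg (Suc n) (\<lambda>k. (rest n k)\<^sup>2) \<le> (\<delta> n)\<^sup>2 * lin_var n"
      using K1(2)[of n] K2(2)[of n] avg_rest_square[of n] by linarith+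
  qed
  define err where "err e N = (\<Sum>n<N. e n * lin_var n) / total_lin_var N" for e N
  have err: "err e \<longlonglongrightarrow> 0" if "e \<longlonglongrightarrow> 0" for e
    using weighted_mean_tendsto_0[OF _ total_lin_var_at_top[unfolded total_lin_var_def[abs_def]] that] lin_var_pos
    by (simp add: err_def[abs_def] total_lin_var_def less_imp_le)
  define e where "e n = (\<delta> n)\<^sup>2 + \<delta> n" for n
  have e_nonneg: "0 \<le> e n" for n using \<delta>(1)[of n] by (simp add: e_def)
  have e: "e \<longlonglongrightarrow> 0"
    using tendsto_add[OF tendsto_power[OF \<delta>_lim, of 2] \<delta>_lim] by (simp add: e_def[abs_def])
  have e2: "(\<lambda>n. 2 * (\<delta> n)\<^sup>2) \<longlonglongrightarrow> 0"
    using tendsto_mult[OF tendsto_const[of 2] tendsto_power[OF \<delta>_lim, of 2]] by simp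

  have V_ratio: "(\<lambda>N. V (Suc N) / total_lin_var N) \<longlonglongrightarrow> 1"
  proof (rule tendsto_sandwich)
    show "(\<lambda>_. 1) \<longlonglongrightarrow> (1::real)" by simp
    show "(\<lambda>N. 1 + err (\<lambda>n. 2 * (\<delta> n)\<^sup>2) N) \<longlonglongrightarrow> 1"
      using tendsto_add[OF tendsto_const[of 1] err[OF e2]] by simp
    show "eventually (\<lambda>N. 1 \<le> V (Suc N) / total_lin_var N) sequentially"
      using total_lin_var_le_V total_lin_var_pos by (intro eventually_sequentiallyI[of 1]) (simp add: pos_le_divide_eq)
    have "avg (Suc n) V + avg (Suc n) (\<lambda>k. (rest n k)\<^sup>2) \<le> 2 * (\<delta> n)\<^sup>2 * lin_var n" for n
      using Vr[of n] rest[of n] by simp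
    then have "V (Suc N) \<le> total_lin_var N + (\<Sum>n<N. 2 * (\<delta> n)\<^sup>2 * lin_var n)" for N
      unfolding V_eq_sum by (intro add_left_mono sum_mono)
    then have "V (Suc N) / total_lin_var N \<le> (total_lin_var N + (\<Sum>n<N. 2 * (\<delta> n)\<^sup>2 * lin_var n)) / total_lin_var N" for N
      by (intro divide_right_mono) (auto simp: total_lin_var_def lin_var_pos less_imp_le intro!: sum_nonneg)
    moreover have "(total_lin_var N + x) / total_lin_var N = 1 + x / total_lin_var N" if "N \<ge> 1" for N x
      using total_lin_var_pos[of N] that by (simp add: add_divide_distrib)
    ultimately show "eventually (\<lambda>N. V (Suc N) / total_lin_var N \<le> 1 + err (\<lambda>n. 2 * (\<delta> n)\<^sup>2) N) sequentially"
      unfolding err_def by (intro eventually_sequentiallyI[of 1]) metis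
  qed
  have V_ratio': "(\<lambda>N. total_lin_var N / V (Suc N)) \<longlonglongrightarrow> 1"
    using tendsto_inverse[OF V_ratio] by simp

  define \<tau> where "\<tau> N = t / sqrt (V (Suc N))" for N
  define w where "w = sqrt (q * (1 - q))"
  have w: "w > 0" using q_pos q_less_1 by (simp add: w_def)
  have close: "norm (\<psi> (Suc N) (\<tau> N) - of_real (exp (- ((\<tau> N)\<^sup>2 * total_lin_var N / 2))))
      \<le> t\<^sup>2 * err e N + 2 * \<bar>t\<bar> ^ 3 / w ^ 3 * err g N" if N: "N \<ge> 1" for N
  proof -
    let ?\<tau> = "\<tau> N" and ?L = "total_lin_var N"
    have L: "?L > 0" using total_lin_var_pos N by simp
    have sqrtL: "sqrt ?L > 0" "sqrt ?L \<le> sqrt (V (Suc N))" using L total_lin_var_le_V by auto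
    have \<tau>: "\<bar>?\<tau>\<bar> \<le> \<bar>t\<bar> / sqrt ?L"
      using sqrtL by (simp add: \<tau>_def divide_left_mono)
    have \<tau>2: "?\<tau>\<^sup>2 \<le> t\<^sup>2 / ?L"
      using power_mono[OF \<tau>, of 2] L by (simp add: power_divide)
    have \<tau>3: "\<bar>?\<tau>\<bar> ^ 3 \<le> \<bar>t\<bar> ^ 3 / sqrt ?L ^ 3"
      using power_mono[OF \<tau>, of 3] by (simp add: power_divide)
    have "norm (\<psi> (Suc N) ?\<tau> - (\<Prod>n<N. bernoulli_char (?\<tau> * slope n) ^ Suc n))
        \<le> (\<Sum>n<N. norm (step_char n ?\<tau> - bernoulli_char (?\<tau> * slope n) ^ Suc n))"
      unfolding \<psi>_eq_prod using norm_bernoulli_char_le norm_step_char_le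
      by (intro norm_prod_diff) (auto simp only: norm_power intro!: power_le_one norm_ge_zero)
    also have "\<dots> \<le> (\<Sum>n<N. ?\<tau>\<^sup>2 * (e n * lin_var n))"
      unfolding e_def by (intro sum_mono step_char_linear_approx \<delta> rest Vr)
    also have "\<dots> = ?\<tau>\<^sup>2 * (\<Sum>n<N. e n * lin_var n)" by (simp add: sum_distrib_left)
    also have "\<dots> \<le> t\<^sup>2 / ?L * (\<Sum>n<N. e n * lin_var n)"
      by (intro mult_right_mono \<tau>2 sum_nonneg mult_nonneg_nonneg e_nonneg less_imp_le[OF lin_var_pos])
    also have "\<dots> = t\<^sup>2 * err e N" by (simp add: err_def)
    finally have 1: "norm (\<psi> (Suc N) ?\<tau> - (\<Prod>n<N. bernoulli_char (?\<tau> * slope n) ^ Suc n)) \<le> t\<^sup>2 * err e N" .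
    let ?G = "\<Sum>n<N. g n * lin_var n"
    have G: "?G \<ge> 0"
      using g(2) lin_var_pos by (intro sum_nonneg) (auto intro!: mult_nonneg_nonneg less_imp_le)
    have "2 * \<bar>?\<tau>\<bar> ^ 3 * (\<Sum>n<N. real (Suc n) * slope n ^ 3)
        \<le> 2 * (\<bar>t\<bar> ^ 3 / sqrt ?L ^ 3) * (sqrt ?L / w ^ 3 * ?G)"
      using third_moments_le[of N] sqrtL slope_nonneg
      by (intro mult_mono mult_left_mono \<tau>3) (auto simp: w_def g_def intro!: sum_nonneg)
    also have "\<dots> = 2 * \<bar>t\<bar> ^ 3 / w ^ 3 * (?G / (sqrt ?L * sqrt ?L))"
    proof -
      have "2 * (a / s ^ 3) * (s / b * c) = 2 * a / b * (c / (s * s))" if "s > 0" for a b c s :: real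
        using that by (simp add: power3_eq_cube mult_ac)
      then show ?thesis using sqrtL(1) by blast
    qed
    also have "\<dots> = 2 * \<bar>t\<bar> ^ 3 / w ^ 3 * err g N" using L by (simp add: err_def)
    finally have 2: "norm ((\<Prod>n<N. bernoulli_char (?\<tau> * slope n) ^ Suc n) - of_real (exp (- (?\<tau>\<^sup>2 * ?L / 2))))
        \<le> 2 * \<bar>t\<bar> ^ 3 / w ^ 3 * err g N"
      using char_product_approx[where t = ?\<tau> and N = N] by linarith
    show ?thesis using norm_triangle_mono[OF 1 2] by simp
  qed
  have bound_lim: "(\<lambda>N. t\<^sup>2 * err e N + 2 * \<bar>t\<bar> ^ 3 / w ^ 3 * err g N) \<longlonglongrightarrow> 0"
    using tendsto_add[OF tendsto_mult[OF tendsto_const[of "t\<^sup>2"] err[OF e]]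
        tendsto_mult[OF tendsto_const[of "2 * \<bar>t\<bar> ^ 3 / w ^ 3"] err[OF g(1)]]] by simp
  have diff_lim: "(\<lambda>N. \<psi> (Suc N) (\<tau> N) - of_real (exp (- ((\<tau> N)\<^sup>2 * total_lin_var N / 2)))) \<longlonglongrightarrow> 0"
    by (rule Lim_null_comparison[OF eventually_sequentiallyI bound_lim]) (rule close)
  have "(\<lambda>N. exp (- (t\<^sup>2 * (total_lin_var N / V (Suc N)) / 2))) \<longlonglongrightarrow> exp (- (t\<^sup>2 * 1 / 2))"
    by (intro tendsto_exp tendsto_minus tendsto_divide tendsto_mult tendsto_const V_ratio') simp
  moreover have "(\<tau> N)\<^sup>2 * total_lin_var N = t\<^sup>2 * (total_lin_var N / V (Suc N))" for N
    by (simp add: \<tau>_def power_divide V_nonneg)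
  ultimately have "(\<lambda>N. exp (- ((\<tau> N)\<^sup>2 * total_lin_var N / 2))) \<longlonglongrightarrow> exp (- (t\<^sup>2 / 2))"
    by simp
  from tendsto_add[OF diff_lim tendsto_of_real[OF this]]
  have "(\<lambda>N. \<psi> (Suc N) (\<tau> N)) \<longlonglongrightarrow> of_real (exp (- (t\<^sup>2 / 2)))"
    by simp
  then show ?thesis unfolding \<tau>_def by (rule LIMSEQ_imp_Suc)
qed

end

section \<open>Moments and characteristic functions of the random variables\<close>

lemma expectation_bind_pmf_finite:
  fixes h :: "'b \<Rightarrow> 'c :: {banach, second_countable_topology}"
  assumes "finite (set_pmf M)" "\<And>x. x \<in> set_pmf M \<Longrightarrow> finite (set_pmf (f x))"
  shows "measure_pmf.expectation (M \<bind> f) h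
    = measure_pmf.expectation M (\<lambda>x. measure_pmf.expectation (f x) h)"
  using assms by (subst pmf_expectation_bind[of "set_pmf M"]) (auto simp: integral_measure_pmf[of "set_pmf M"])

text \<open>
  The recurrence uses the number of failures, which is binomial as well.
\<close>
lemma expectation_binomial_pmf_complement:
  fixes f :: "nat \<Rightarrow> 'a :: {banach, second_countable_topology}"
  assumes "0 < p" "p < 1"
  shows "measure_pmf.expectation (binomial_pmf n p) (\<lambda>k. f (n - k))
    = measure_pmf.expectation (binomial_pmf n (1 - p)) f"
proof -
  have "(\<Sum>k\<le>n. (real (n choose k) * p ^ k * (1 - p) ^ (n - k)) *\<^sub>R f (n - k))
      = (\<Sum>k\<le>n. (real (n choose k) * (1 - p) ^ k * p ^ (n - k)) *\<^sub>R f k)"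
    by (rule sum.reindex_bij_witness[of _ "\<lambda>k. n - k" "\<lambda>k. n - k"])
      (auto simp: binomial_symmetric[symmetric] mult_ac)
  then show ?thesis using assms by (simp add: expectation_binomial_pmf')
qed

lemma finite_set_Y_pmf:
  assumes "0 < p" "p < 1"
  shows "finite (set_pmf (Y_pmf p n))"
proof (induction n rule: less_induct)
  case (less n)
  show ?case using less assms
    by (subst Y_pmf.simps) (auto simp: set_bind_pmf)
qed

locale Y_sequence =
  fixes p :: real
  assumes p_pos: "0 < p" and p_less_1: "p < 1"
begin

sublocale binomial_average "1 - p"
  using p_pos p_less_1 by unfold_locales auto

abbreviation expect :: "nat \<Rightarrow> (nat \<Rightarrow> 'a :: {banach, second_countable_topology}) \<Rightarrow> 'a" where
  "expect n f \<equiv> measure_pmf.expectation (Y_pmf p n) f"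

lemma Y_integrable: "integrable (Y_pmf p n) (f :: nat \<Rightarrow> 'a :: {banach, second_countable_topology})"
  by (intro integrable_measure_pmf_finite finite_set_Y_pmf p_pos p_less_1)

lemma expect_Suc:
  fixes f :: "nat \<Rightarrow> 'a :: {banach, second_countable_topology}"
  assumes "n \<ge> 1"
  shows "expect (Suc n) f = expect n (\<lambda>y. avg n (\<lambda>j. expect j (\<lambda>y'. f (y + y'))))"
proof -
  note fin = finite_set_Y_pmf[OF p_pos p_less_1]
  have "Y_pmf p (Suc n) = Y_pmf p n \<bind> (\<lambda>y. binomial_pmf n p \<bind> (\<lambda>k. Y_pmf p (n - k) \<bind>
      (\<lambda>y'. return_pmf (y + y'))))"
    using assms by (subst Y_pmf.simps) simp
  then have "expect (Suc n) f = expect n (\<lambda>y. measure_pmf.expectation (binomial_pmf n p)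
      (\<lambda>k. expect (n - k) (\<lambda>y'. f (y + y'))))"
    using fin p_pos p_less_1
    by (simp add: expectation_bind_pmf_finite set_bind_pmf finite_set_pmf_binomial_pmf)
  also have "\<dots> = expect n (\<lambda>y. avg n (\<lambda>j. expect j (\<lambda>y'. f (y + y'))))"
    unfolding avg_def
    by (subst expectation_binomial_pmf_complement[OF p_pos p_less_1, symmetric]) (rule refl)
  finally show ?thesis .
qed

lemma expect_add: "expect n (\<lambda>y. f y + g y) = expect n f + expect n g"
  by (intro Bochner_Integration.integral_add Y_integrable)

lemma expect_cmult: "expect n (\<lambda>y. c * f y) = (c :: real) * expect n f"
  by simp

lemma expect_const: "expect n (\<lambda>y. c) = c"
  by simp

definition \<mu> :: "nat \<Rightarrow> real" where "\<mu> n = expect n real"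

definition var :: "nat \<Rightarrow> real" where "var n = expect n (\<lambda>y. (real y - \<mu> n)\<^sup>2)"

definition centred_char :: "nat \<Rightarrow> real \<Rightarrow> complex" where
  "centred_char n t = expect n (\<lambda>y. iexp (t * (real y - \<mu> n)))"

lemma \<mu>_0: "\<mu> 0 = 0" and \<mu>_1: "\<mu> 1 = 1"
  by (simp_all add: \<mu>_def Y_pmf_0 Y_pmf_1[simplified])

lemma \<mu>_Suc: "n \<ge> 1 \<Longrightarrow> \<mu> (Suc n) = \<mu> n + avg n \<mu>"
  unfolding \<mu>_def expect_Suc by (simp add: Y_integrable avg_add)

lemma expect_centred: "expect n (\<lambda>y. real y - \<mu> n) = 0"
  by (simp add: Y_integrable \<mu>_def)

lemma expect_shifted_square: "expect n (\<lambda>y. (real y - c)\<^sup>2) = var n + (\<mu> n - c)\<^sup>2"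
proof -
  have "expect n (\<lambda>y. (real y - c)\<^sup>2)
      = expect n (\<lambda>y. ((real y - \<mu> n)\<^sup>2 + 2 * (\<mu> n - c) * (real y - \<mu> n)) + (\<mu> n - c)\<^sup>2)"
    by (intro Bochner_Integration.integral_cong) (auto simp: power2_eq_square algebra_simps)
  also have "\<dots> = var n + 2 * (\<mu> n - c) * expect n (\<lambda>y. real y - \<mu> n) + (\<mu> n - c)\<^sup>2"
    unfolding var_def by (simp only: expect_add expect_cmult expect_const)
  finally show ?thesis by (simp only: expect_centred mult_zero_right add_0_right)
qed

lemma var_Suc: "var (Suc n) = var n + avg n var + (avg n (\<lambda>k. (\<mu> k)\<^sup>2) - (avg n \<mu>)\<^sup>2)"
proof (cases "n = 0")
  case True
  then show ?thesis using \<mu>_0 \<mu>_1 by (simp add: var_def Y_pmf_0 Y_pmf_1[simplified])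
next
  case False
  let ?T = "avg n \<mu>"
  have "var (Suc n) = expect n (\<lambda>y. avg n (\<lambda>j. expect j (\<lambda>y'. (real y' - (\<mu> n + ?T - real y))\<^sup>2)))"
    using False unfolding var_def by (subst expect_Suc) (simp_all add: \<mu>_Suc algebra_simps)
  also have "\<dots> = expect n (\<lambda>y. avg n (\<lambda>j. var j + (\<mu> j - (\<mu> n + ?T - real y))\<^sup>2))"
    unfolding expect_shifted_square ..
  also have "\<dots> = expect n (\<lambda>y. (avg n var + (avg n (\<lambda>k. (\<mu> k)\<^sup>2) - ?T\<^sup>2)) + (real y - \<mu> n)\<^sup>2)"
    unfolding avg_add avg_square_expand
    by (intro Bochner_Integration.integral_cong) (auto simp: power2_eq_square algebra_simps)
  also have "\<dots> = avg n var + (avg n (\<lambda>k. (\<mu> k)\<^sup>2) - ?T\<^sup>2) + var n"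
    unfolding var_def[of n] by (subst Bochner_Integration.integral_add) (simp_all add: Y_integrable)
  finally show ?thesis by simp
qed

lemma centred_char_Suc:
  "centred_char (Suc n) t
    = centred_char n t * avg n (\<lambda>k. iexp (t * (\<mu> k - avg n \<mu>)) * centred_char k t)"
proof (cases "n = 0")
  case True
  then show ?thesis using \<mu>_0 \<mu>_1 by (simp add: centred_char_def Y_pmf_0 Y_pmf_1[simplified])
next
  case False
  let ?T = "avg n \<mu>"
  have split: "iexp (t * (real (y + y') - \<mu> (Suc n)))
      = iexp (t * (real y - \<mu> n)) * (iexp (t * (\<mu> j - ?T)) * iexp (t * (real y' - \<mu> j)))" for y y' j
    using False by (simp add: \<mu>_Suc exp_add [symmetric] algebra_simps)
  have "centred_char (Suc n) t
      = expect n (\<lambda>y. avg n (\<lambda>j. expect j (\<lambda>y'. iexp (t * (real (y + y') - \<mu> (Suc n))))))"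
    using False unfolding centred_char_def by (intro expect_Suc) simp
  also have "\<dots> = expect n (\<lambda>y. avg n (\<lambda>j. iexp (t * (real y - \<mu> n)) * (iexp (t * (\<mu> j - ?T)) * centred_char j t)))"
  proof -
    have "expect j (\<lambda>y'. iexp (t * (real (y + y') - \<mu> (Suc n))))
        = iexp (t * (real y - \<mu> n)) * (iexp (t * (\<mu> j - ?T)) * centred_char j t)" for y j
      unfolding split[of y _ j] centred_char_def by simp
    then show ?thesis by (simp only:)
  qed
  also have "\<dots> = centred_char n t * avg n (\<lambda>k. iexp (t * (\<mu> k - ?T)) * centred_char k t)"
    unfolding avg_cmult centred_char_def by simp
  finally show ?thesis .
qed

lemma norm_centred_char_le: "norm (centred_char n t) \<le> 1"
proof -
  have "norm (centred_char n t) \<le> expect n (\<lambda>y. norm (iexp (t * (real y - \<mu> n))))"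
    unfolding centred_char_def by (rule integral_norm_bound)
  then show ?thesis by simp
qed

lemma centred_char_second_order: "norm (centred_char n t - 1) \<le> t\<^sup>2 / 2 * var n"
proof -
  let ?x = "\<lambda>y. t * (real y - \<mu> n)"
  have "expect n (\<lambda>y. iexp (?x y) - 1 - \<i> * ?x y)
      = centred_char n t - 1 - \<i> * t * expect n (\<lambda>y. complex_of_real (real y - \<mu> n))"
    unfolding centred_char_def
    by (simp add: Y_integrable mult.assoc del: of_real_diff)
  also have "expect n (\<lambda>y. complex_of_real (real y - \<mu> n)) = 0"
    by (simp only: integral_complex_of_real expect_centred) simp
  finally have "norm (centred_char n t - 1) = norm (expect n (\<lambda>y. iexp (?x y) - 1 - \<i> * ?x y))" by simp
  also have "\<dots> \<le> expect n (\<lambda>y. norm (iexp (?x y) - 1 - \<i> * ?x y))" by (rule integral_norm_bound)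
  also have "\<dots> \<le> expect n (\<lambda>y. t\<^sup>2 / 2 * (real y - \<mu> n)\<^sup>2)"
  proof (intro integral_mono Y_integrable)
    fix y
    show "norm (iexp (?x y) - 1 - \<i> * ?x y) \<le> t\<^sup>2 / 2 * (real y - \<mu> n)\<^sup>2"
      using norm_iexp_diff_linear_le[of "?x y"] by (simp add: power_mult_distrib)
  qed
  also have "\<dots> = t\<^sup>2 / 2 * var n" unfolding var_def by simp
  finally show ?thesis .
qed

sublocale char_recurrence "1 - p" \<mu> var centred_char
proof
  show "\<mu> 0 = 0" "\<mu> 1 = 1" by (rule \<mu>_0 \<mu>_1)+
  show "\<mu> (Suc n) = \<mu> n + avg n \<mu>" if "n \<ge> 1" for n using that by (rule \<mu>_Suc)
  show "var 0 = 0" by (simp add: var_def \<mu>_0 Y_pmf_0)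
  show "centred_char 0 t = 1" for t by (simp add: centred_char_def \<mu>_0 Y_pmf_0)
qed (rule var_Suc centred_char_Suc norm_centred_char_le centred_char_second_order)+

lemma char_normalised:
  "char (distr (Y_pmf p n) borel (\<lambda>y. (real y - Y_mean p n) / Y_sd p n)) t
    = centred_char n (t / sqrt (var n))"
proof -
  have "Y_mean p n = \<mu> n" "Y_sd p n = sqrt (var n)"
    by (simp_all add: Y_mean_def Y_sd_def \<mu>_def var_def)
  then show ?thesis
    unfolding char_def centred_char_def by (subst integral_distr) (auto simp: mult_ac)
qed

end

theorem theorem5p1:
  fixes p :: real
  assumes "0 < p" and "p < 1"
  shows "weak_conv_m
           (\<lambda>n. distr (measure_pmf (Y_pmf p n)) borel (\<lambda>y. (real y - Y_mean p n) / Y_sd p n))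
           std_normal_distribution"
proof (rule levy_continuity)
  interpret Y_sequence p using assms by unfold_locales
  show "real_distribution (distr (measure_pmf (Y_pmf p n)) borel (\<lambda>y. (real y - Y_mean p n) / Y_sd p n))" for n
    by (intro prob_space.real_distribution_distr measure_pmf.prob_space_axioms) auto
  show "(\<lambda>n. char (distr (measure_pmf (Y_pmf p n)) borel (\<lambda>y. (real y - Y_mean p n) / Y_sd p n)) t)
      \<longlonglongrightarrow> char std_normal_distribution t" for t
    unfolding char_normalised char_std_normal_distribution using \<psi>_tendsto_normal[of t] by simp
qed (rule real_dist_normal_dist)

end
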